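(* Let $(E,\mathcal{B})$ be a Lusin measurable space, $m$ a measure on $(E,\mathcal{B})$ with $m(E)<\infty$, and let $(\mathcal{E},D(\mathcal{E}))$ be a (not necessarily symmetric) Dirichlet form on $L^2(E,m)$ satisfying the strong sector condition. Let $\mathcal{U}=(U_\alpha)_{\alpha>0}$ be its resolvent, $(\mathsf{L},D(\mathsf{L}))$ its generator, and $\widetilde{\mathcal{E}}$ its symmetric part. (i) The following assertions are equivalent. (i.1) $\mathcal{E}$ is recurrent. (i.2) $\widetilde{\mathcal{E}}$ is recurrent. (i.3) $1\in D(\mathcal{E})$ and $\mathcal{E}(1,1)=0$. (ii) If $\mathcal{E}$ is recurrent then the following assertions are equivalent. (ii.1) $\mathcal{E}$ is irreducible. (ii.2) $\widetilde{\mathcal{E}}$ is irreducible. (ii.3) If $u\in D(\mathcal{E})$ and $\mathcal{E}(u,u)=0$ then $u$ is constant. (ii.4) If $u\in D(\mathsf{L})$ and $\mathsf{L}u=0$ then $u$ is constant. (ii.5) If $u\in D(\mathsf{L})$ is such that for all $v\in D(\mathsf{L})$ we have $uv\in D(\mathsf{L})$ and $\mathsf{L}(uv)=u\,\mathsf{L}v$, then $u$ is constant. (ii.6) $\int\big(\alpha U_\alpha u-\frac{1}{m(E)}\int u\,dm\big)^2dm\to0$ as $\alpha\to0$, for all $u\in L^2(E,m)$.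
   Context: "Dirichlet form" is in the sense of Ma–Röckner: a densely defined closed coercive (weakly sectorial) bilinear form on $L^2(E,m)$ such that for $u\in D(\mathcal{E})$ one has $u^+\wedge1\in D(\mathcal{E})$, $\mathcal{E}(u+u^+\wedge1,u-u^+\wedge1)\ge0$ and $\mathcal{E}(u-u^+\wedge1,u+u^+\wedge1)\ge0$. Strong sector condition: there is $k>0$ with $|\mathcal{E}(u,v)|\le k\,\mathcal{E}(u,u)^{1/2}\mathcal{E}(v,v)^{1/2}$ for all $u,v\in D(\mathcal{E})$. The symmetric part is $\widetilde{\mathcal{E}}(u,v)=\frac12(\mathcal{E}(u,v)+\mathcal{E}(v,u))$, $D(\widetilde{\mathcal{E}})=D(\mathcal{E})$. The resolvent $\mathcal{U}$ and co-resolvent $\mathcal{U}^\ast$ are determined by $U_\alpha(L^2),U^\ast_\alpha(L^2)\subset D(\mathcal{E})$ and $\mathcal{E}_\alpha(U_\alpha f,u)=\mathcal{E}_\alpha(u,U^\ast_\alpha f)=(f,u)_{L^2(E,m)}$ for all $\alpha>0$, $f\in L^2(E,m)$, $u\in D(\mathcal{E})$, with $\mathcal{E}_\alpha=\mathcal{E}+\alpha(\cdot,\cdot)_{L^2(E,m)}$. They are strongly continuous sub-Markovian resolvents of contractions on $L^2(E,m)$, and may be taken to be given by sub-Markovian resolvents of kernels on $(E,\mathcal{B})$ in weak duality with respect to $m$ ($\int fU_\alpha g\,dm=\int gU^\ast_\alpha f\,dm$ for positive measurable $f,g$); $m$ is sub-invariant for $\mathcal{U}$ ($m\circ\alpha U_\alpha\le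 m$). The generator is $D(\mathsf{L})=U_\alpha(L^2(E,m))$, $\mathsf{L}(U_\alpha f)=\alpha U_\alpha f-f$. Let $U=\sup_\alpha U_\alpha$. $\mathcal{E}$ is recurrent if $m(\{0<Uf<\infty\})=0$ for every positive $f\in L^1(E,m)$. $\mathcal{E}$ is irreducible if every $A\in\mathcal{B}$ with $U(1_{E\setminus A})=0$ $m$-a.e. on $A$ satisfies $m(A)=0$ or $m(E\setminus A)=0$. The same definitions apply to $\widetilde{\mathcal{E}}$ with its own resolvent. "Constant" means $m$-a.e. constant. *)

theory Defs
  imports "HOL-Analysis.Analysis"
begin

text \<open>
  A measurable space is Lusin if it is measurably isomorphic to a Borel subset of a compact
  metrizable space.  A compact metrizable space has at most the cardinality of the continuum, so
  letting the topology \<open>K\<close> range over all topologies whose carrier is a set of reals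
  covers all of them up to homeomorphism; the usual topology of the reals plays no role.
\<close>

definition lusin_measurable_space :: "'a measure \<Rightarrow> bool" where
  "lusin_measurable_space M \<longleftrightarrow>
    (\<exists>(K :: real topology) H \<phi> \<psi>.
      compact_space K \<and> metrizable_space K \<and>
      H \<in> sigma_sets (topspace K) {V. openin K V} \<and>
      (let N = restrict_space (sigma (topspace K) {V. openin K V}) H in
        \<phi> \<in> measurable M N \<and> \<psi> \<in> measurable N M \<and>
        (\<forall>x\<in>space M. \<psi> (\<phi> x) = x) \<and> (\<forall>y\<in>space N. \<phi> (\<psi> y) = y)))"


text \<open>
  Elements of \<open>L\<^sup>2\<close> are represented by functions; accordingly a form domain is required to
  be saturated under equality almost everywhere, and the form to be invariant under it.
\<close>

definition L2 :: "'a measure \<Rightarrow> ('a \<Rightarrow> real) set" where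
  "L2 m = {f \<in> borel_measurable m. integrable m (\<lambda>x. (f x)\<^sup>2)}"

definition L2_inner :: "'a measure \<Rightarrow> ('a \<Rightarrow> real) \<Rightarrow> ('a \<Rightarrow> real) \<Rightarrow> real" where
  "L2_inner m f g = (\<integral>x. f x * g x \<partial>m)"

definition ae_constant :: "'a measure \<Rightarrow> ('a \<Rightarrow> real) \<Rightarrow> bool" where
  "ae_constant m u \<longleftrightarrow> (\<exists>c. AE x in m. u x = c)"

type_synonym 'a form = "('a \<Rightarrow> real) \<Rightarrow> ('a \<Rightarrow> real) \<Rightarrow> real"

definition form_shift :: "'a measure \<Rightarrow> 'a form \<Rightarrow> real \<Rightarrow> 'a form" where
  "form_shift m \<E> \<alpha> u v = \<E> u v + \<alpha> * L2_inner m u v"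

definition sym_part :: "'a form \<Rightarrow> 'a form" where
  "sym_part \<E> u v = (\<E> u v + \<E> v u) / 2"

locale bilinear_form_L2 =
  fixes m :: "'a measure" and D :: "('a \<Rightarrow> real) set" and \<E> :: "'a form"
  assumes D_subset: "D \<subseteq> L2 m"
    and D_cong: "\<And>u v. u \<in> D \<Longrightarrow> v \<in> borel_measurable m \<Longrightarrow> AE x in m. u x = v x \<Longrightarrow> v \<in> D"
    and form_cong: "\<And>u v w. u \<in> D \<Longrightarrow> v \<in> D \<Longrightarrow> w \<in> D \<Longrightarrow> AE x in m. u x = v x \<Longrightarrow>
        \<E> u w = \<E> v w \<and> \<E> w u = \<E> w v"
    and D_zero: "(\<lambda>x. 0) \<in> D"
    and D_add: "\<And>u v. u \<in> D \<Longrightarrow> v \<in> D \<Longrightarrow> (\<lambda>x. u x + v x) \<in> D"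
    and D_scale: "\<And>c u. u \<in> D \<Longrightarrow> (\<lambda>x. c * u x) \<in> D"
    and form_add_left: "\<And>u v w. u \<in> D \<Longrightarrow> v \<in> D \<Longrightarrow> w \<in> D \<Longrightarrow>
        \<E> (\<lambda>x. u x + v x) w = \<E> u w + \<E> v w"
    and form_add_right: "\<And>u v w. u \<in> D \<Longrightarrow> v \<in> D \<Longrightarrow> w \<in> D \<Longrightarrow>
        \<E> w (\<lambda>x. u x + v x) = \<E> w u + \<E> w v"
    and form_scale_left: "\<And>c u w. u \<in> D \<Longrightarrow> w \<in> D \<Longrightarrow> \<E> (\<lambda>x. c * u x) w = c * \<E> u w"
    and form_scale_right: "\<And>c u w. u \<in> D \<Longrightarrow> w \<in> D \<Longrightarrow> \<E> w (\<lambda>x. c * u x) = c * \<E> w u"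

locale coercive_closed_form = bilinear_form_L2 +
  assumes dense: "\<And>f \<epsilon>. f \<in> L2 m \<Longrightarrow> \<epsilon> > 0 \<Longrightarrow> \<exists>u\<in>D. (\<integral>x. (f x - u x)\<^sup>2 \<partial>m) < \<epsilon>"
    and nonneg: "\<And>u. u \<in> D \<Longrightarrow> \<E> u u \<ge> 0"
    and closed: "\<And>u :: nat \<Rightarrow> 'a \<Rightarrow> real. (\<And>n. u n \<in> D) \<Longrightarrow>
        (\<And>\<epsilon>. \<epsilon> > 0 \<Longrightarrow> \<exists>N. \<forall>i\<ge>N. \<forall>j\<ge>N.
          form_shift m (sym_part \<E>) 1 (\<lambda>x. u i x - u j x) (\<lambda>x. u i x - u j x) < \<epsilon>) \<Longrightarrow>
        \<exists>w\<in>D. (\<lambda>n. form_shift m (sym_part \<E>) 1 (\<lambda>x. u n x - w x) (\<lambda>x. u n x - w x))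
          \<longlonglongrightarrow> 0"
    and weak_sector: "\<exists>K>0. \<forall>u\<in>D. \<forall>v\<in>D.
        \<bar>form_shift m \<E> 1 u v\<bar> \<le> K * sqrt (form_shift m \<E> 1 u u) * sqrt (form_shift m \<E> 1 v v)"

definition unit_contraction :: "('a \<Rightarrow> real) \<Rightarrow> 'a \<Rightarrow> real" where
  "unit_contraction u x = min (max (u x) 0) 1"

locale dirichlet_form = coercive_closed_form +
  assumes contraction_mem: "\<And>u. u \<in> D \<Longrightarrow> unit_contraction u \<in> D"
    and contraction_left: "\<And>u. u \<in> D \<Longrightarrow>
        \<E> (\<lambda>x. u x + unit_contraction u x) (\<lambda>x. u x - unit_contraction u x) \<ge> 0"
    and contraction_right: "\<And>u. u \<in> D \<Longrightarrow>
        \<E> (\<lambda>x. u x - unit_contraction u x) (\<lambda>x. u x + unit_contraction u x) \<ge> 0"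

definition strong_sector :: "('a \<Rightarrow> real) set \<Rightarrow> 'a form \<Rightarrow> bool" where
  "strong_sector D \<E> \<longleftrightarrow>
    (\<exists>k>0. \<forall>u\<in>D. \<forall>v\<in>D. \<bar>\<E> u v\<bar> \<le> k * sqrt (\<E> u u) * sqrt (\<E> v v))"


text \<open>
  In \<open>U \<alpha> x A\<close> the measure \<open>U \<alpha> x\<close> is the kernel \<open>U\<^sub>\<alpha>(x, \<cdot>)\<close>.  The resolvent equation
  is stated for all pairs \<open>\<alpha>, \<beta> > 0\<close>, so it includes the commutation of
  \<open>U\<^sub>\<alpha>\<close> and \<open>U\<^sub>\<beta>\<close>.
\<close>

type_synonym 'a kernel_family = "real \<Rightarrow> 'a \<Rightarrow> 'a measure"

locale sub_markov_resolvent =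
  fixes m :: "'a measure" and U :: "'a kernel_family"
  assumes sets_kernel: "\<And>\<alpha> x. \<alpha> > 0 \<Longrightarrow> x \<in> space m \<Longrightarrow> sets (U \<alpha> x) = sets m"
    and measurable_kernel: "\<And>\<alpha> A. \<alpha> > 0 \<Longrightarrow> A \<in> sets m \<Longrightarrow>
        (\<lambda>x. emeasure (U \<alpha> x) A) \<in> borel_measurable m"
    and sub_markov: "\<And>\<alpha> x. \<alpha> > 0 \<Longrightarrow> x \<in> space m \<Longrightarrow>
        ennreal \<alpha> * emeasure (U \<alpha> x) (space m) \<le> 1"
    and resolvent_equation: "\<And>\<alpha> \<beta> x A. \<alpha> > 0 \<Longrightarrow> \<beta> > 0 \<Longrightarrow> x \<in> space m \<Longrightarrow> A \<in> sets m \<Longrightarrow>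
        measure (U \<alpha> x) A - measure (U \<beta> x) A
          = (\<beta> - \<alpha>) * (\<integral>y. measure (U \<beta> y) A \<partial>U \<alpha> x)"

text \<open>
  For \<open>f\<close> in \<open>L\<^sup>2\<close> the integral below may fail to exist on a null set of points \<open>x\<close>, where
  it takes the default value 0.
\<close>

definition kernel_op :: "'a kernel_family \<Rightarrow> real \<Rightarrow> ('a \<Rightarrow> real) \<Rightarrow> 'a \<Rightarrow> real" where
  "kernel_op U \<alpha> f x = (\<integral>y. f y \<partial>U \<alpha> x)"

definition resolvent_of_form ::
    "'a measure \<Rightarrow> ('a \<Rightarrow> real) set \<Rightarrow> 'a form \<Rightarrow> 'a kernel_family \<Rightarrow> bool" where
  "resolvent_of_form m D \<E> U \<longleftrightarrow>
    sub_markov_resolvent m U \<and>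
    (\<forall>\<alpha>>0. \<forall>f\<in>L2 m. kernel_op U \<alpha> f \<in> D \<and>
      (\<forall>u\<in>D. form_shift m \<E> \<alpha> (kernel_op U \<alpha> f) u = L2_inner m f u))"

definition potential :: "'a kernel_family \<Rightarrow> ('a \<Rightarrow> ennreal) \<Rightarrow> 'a \<Rightarrow> ennreal" where
  "potential U f x = (SUP \<alpha>\<in>{0<..}. \<integral>\<^sup>+y. f y \<partial>U \<alpha> x)"

definition recurrent :: "'a measure \<Rightarrow> 'a kernel_family \<Rightarrow> bool" where
  "recurrent m U \<longleftrightarrow>
    (\<forall>f. integrable m f \<and> (\<forall>x\<in>space m. 0 \<le> f x) \<longrightarrow>
      {x \<in> space m. 0 < potential U (\<lambda>y. ennreal (f y)) x \<and>
        potential U (\<lambda>y. ennreal (f y)) x < \<infinity>} \<in> null_sets m)"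

definition irreducible_resolvent :: "'a measure \<Rightarrow> 'a kernel_family \<Rightarrow> bool" where
  "irreducible_resolvent m U \<longleftrightarrow>
    (\<forall>A\<in>sets m. (AE x in m. x \<in> A \<longrightarrow> potential U (indicator (space m - A)) x = 0) \<longrightarrow>
      emeasure m A = 0 \<or> emeasure m (space m - A) = 0)"


text \<open>
  The graph of the generator, \<open>\<L> (U\<^sub>\<alpha> f) = \<alpha> U\<^sub>\<alpha> f - f\<close>, up to equality almost
  everywhere.  For the resolvent of a Dirichlet form it does not depend on \<open>\<alpha>\<close>, and the value is
  unique almost everywhere, so that \<open>generator\<close> is well defined up to null sets.
\<close>

definition generator_graph ::
    "'a measure \<Rightarrow> 'a kernel_family \<Rightarrow> ('a \<Rightarrow> real) \<Rightarrow> ('a \<Rightarrow> real) \<Rightarrow> bool" where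
  "generator_graph m U u w \<longleftrightarrow> u \<in> L2 m \<and> w \<in> L2 m \<and>
    (\<exists>\<alpha>>0. \<exists>f\<in>L2 m. (AE x in m. u x = kernel_op U \<alpha> f x) \<and>
      (AE x in m. w x = \<alpha> * kernel_op U \<alpha> f x - f x))"

definition generator_dom :: "'a measure \<Rightarrow> 'a kernel_family \<Rightarrow> ('a \<Rightarrow> real) set" where
  "generator_dom m U = {u. \<exists>w. generator_graph m U u w}"

definition generator :: "'a measure \<Rightarrow> 'a kernel_family \<Rightarrow> ('a \<Rightarrow> real) \<Rightarrow> 'a \<Rightarrow> real" where
  "generator m U u = (SOME w. generator_graph m U u w)"

end

theory Submission
  imports Defs
begin

text \<open>
  Recurrence makes \<open>U 1 = \<infinity>\<close> almost everywhere, and the truncations of \<open>U\<^sub>\<alpha> 1 / k\<close> have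
  energy at most \<open>m(E) / k\<close> while tending to 1, so 1 has energy 0 by closedness.  Conversely, if 1
  has energy 0 then \<open>\<alpha> U\<^sub>\<alpha>\<close> preserves the total mass, so bounded excessive functions are
  invariant and a potential is either 0 or \<open>\<infinity>\<close>.

  By the strong sector condition a function of energy 0 is \<open>\<E>\<close>-orthogonal to the whole domain on
  both sides; such functions are exactly the fixed points of \<open>\<alpha> U\<^sub>\<alpha>\<close>, and also the kernel of the
  generator.  Their superlevel sets have indicators of energy 0, and indicators of energy 0 are
  those of the invariant sets.  Everything therefore depends only on the diagonal \<open>\<E>(u, u)\<close>,
  which is the same for the symmetric part.  The convergence of \<open>\<alpha> U\<^sub>\<alpha> u\<close> is von Neumann's mean
  ergodic argument.
\<close>

section \<open>Square integrable functions\<close>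

text \<open>The bound that the resolvent identity gives for the energy of
  \<open>U\<^sub>\<alpha> 1 / k\<close> involves the integral of \<open>U\<^sub>\<alpha> 1\<close>,
  which recurrence makes large. So truncations c of u are estimated by \<E>(c, c) \<le> \<E>(u, c):
  the right side is explicit for a resolvent image u, and c lies between 0 and 1. Mass preservation
  comes from putting 1 into the second argument of \<E>. That \<E>(v, 1) = 0 follows from \<E>(1, 1)
  = 0 is where the strong sector condition does the work of duality with the co-resolvent. The form
  fixes \<open>U\<^sub>\<alpha> f\<close> only up to a null set, and the integral defining it may
  take its default value. Operator identities are therefore obtained almost everywhere by testing
  against \<open>D\<close>, and where many parameters are needed at once they are restricted to
  \<alpha> = 1/(n+1), so that the exceptional sets can be united.\<close>

lemma L2_measurable: "f \<in> L2 m \<Longrightarrow> f \<in> borel_measurable m"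
  by (simp add: L2_def)

lemma L2_integrable_mult:
  assumes "f \<in> L2 m" "g \<in> L2 m"
  shows "integrable m (\<lambda>x. f x * g x)"
proof (rule Bochner_Integration.integrable_bound)
  show "integrable m (\<lambda>x. (f x)\<^sup>2 + (g x)\<^sup>2)"
    using assms by (simp add: L2_def)
  show "(\<lambda>x. f x * g x) \<in> borel_measurable m"
    using assms by (auto simp: L2_def)
  have "\<bar>a * b\<bar> \<le> a\<^sup>2 + b\<^sup>2" for a b :: real
  proof -
    have "2 * (\<bar>a\<bar> * \<bar>b\<bar>) \<le> a\<^sup>2 + b\<^sup>2"
      using sum_squares_bound[of "\<bar>a\<bar>" "\<bar>b\<bar>"] by (simp add: mult.assoc)
    moreover have "0 \<le> a\<^sup>2 + b\<^sup>2"
      by simp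
    ultimately show ?thesis
      unfolding abs_mult by linarith
  qed
  then show "AE x in m. norm (f x * g x) \<le> norm ((f x)\<^sup>2 + (g x)\<^sup>2)"
    by (simp add: abs_mult)
qed

lemma L2_add: "f \<in> L2 m \<Longrightarrow> g \<in> L2 m \<Longrightarrow> (\<lambda>x. f x + g x) \<in> L2 m"
  using L2_integrable_mult[of f m g] by (auto simp: L2_def power2_sum mult.assoc)

lemma L2_scale: "f \<in> L2 m \<Longrightarrow> (\<lambda>x. c * f x) \<in> L2 m"
  by (auto simp: L2_def power_mult_distrib)

lemma L2_diff: "f \<in> L2 m \<Longrightarrow> g \<in> L2 m \<Longrightarrow> (\<lambda>x. f x - g x) \<in> L2 m"
  using L2_add[OF _ L2_scale[of g m "-1"]] by simp

lemma L2_inner_commute: "L2_inner m f g = L2_inner m g f"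
  by (simp add: L2_inner_def mult.commute)

lemma L2_inner_add_left:
  "f \<in> L2 m \<Longrightarrow> g \<in> L2 m \<Longrightarrow> h \<in> L2 m \<Longrightarrow>
    L2_inner m (\<lambda>x. f x + g x) h = L2_inner m f h + L2_inner m g h"
  by (simp add: L2_inner_def distrib_right L2_integrable_mult)

lemma L2_inner_diff_left:
  "f \<in> L2 m \<Longrightarrow> g \<in> L2 m \<Longrightarrow> h \<in> L2 m \<Longrightarrow>
    L2_inner m (\<lambda>x. f x - g x) h = L2_inner m f h - L2_inner m g h"
  by (simp add: L2_inner_def left_diff_distrib L2_integrable_mult)

lemma L2_inner_scale_left: "L2_inner m (\<lambda>x. c * f x) h = c * L2_inner m f h"
  by (simp add: L2_inner_def mult.assoc)

lemma L2_inner_add_right: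
  "f \<in> L2 m \<Longrightarrow> g \<in> L2 m \<Longrightarrow> h \<in> L2 m \<Longrightarrow>
    L2_inner m h (\<lambda>x. f x + g x) = L2_inner m h f + L2_inner m h g"
  by (simp add: L2_inner_commute[of m h] L2_inner_add_left)

lemma L2_inner_diff_right:
  "f \<in> L2 m \<Longrightarrow> g \<in> L2 m \<Longrightarrow> h \<in> L2 m \<Longrightarrow>
    L2_inner m h (\<lambda>x. f x - g x) = L2_inner m h f - L2_inner m h g"
  by (simp add: L2_inner_commute[of m h] L2_inner_diff_left)

lemma L2_inner_scale_right: "L2_inner m h (\<lambda>x. c * f x) = c * L2_inner m h f"
  by (simp add: L2_inner_commute[of m h] L2_inner_scale_left)

lemmas L2_inner_simps = L2_inner_add_left L2_inner_diff_left L2_inner_scale_left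
  L2_inner_add_right L2_inner_diff_right L2_inner_scale_right L2_add L2_diff L2_scale

lemma L2_inner_self_nonneg: "L2_inner m f f \<ge> 0"
  by (simp add: L2_inner_def)

lemma L2_inner_self_eq_0:
  assumes "f \<in> L2 m" "L2_inner m f f = 0"
  shows "AE x in m. f x = 0"
  using integral_nonneg_eq_0_iff_AE[of m "\<lambda>x. f x * f x"] L2_integrable_mult[OF assms(1,1)] assms(2)
  by (auto simp: L2_inner_def)

lemma L2_inner_eq_0_AE:
  assumes "AE x in m. f x = 0"
  shows "L2_inner m f g = 0"
proof -
  have "AE x in m. f x * g x = 0"
    using assms by auto
  then show ?thesis
    unfolding L2_inner_def by (rule integral_eq_zero_AE)
qed

lemma L2_inner_cong_AE:
  assumes "f \<in> L2 m" "g \<in> L2 m" "h \<in> L2 m" "AE x in m. f x = g x"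
  shows "L2_inner m f h = L2_inner m g h"
proof -
  have "AE x in m. f x - g x = 0"
    using assms(4) by auto
  then show ?thesis
    using assms(1-3) L2_inner_eq_0_AE[of "\<lambda>x. f x - g x" m h] by (simp add: L2_inner_diff_left)
qed

lemma L2_inner_self_cong_AE:
  assumes "f \<in> L2 m" "g \<in> L2 m" "AE x in m. f x = g x"
  shows "L2_inner m f f = L2_inner m g g"
  using L2_inner_cong_AE[OF assms(1,2,1,3)] L2_inner_cong_AE[OF assms(1,2,2,3)]
  by (simp add: L2_inner_commute[of m g f])

text \<open>Norms stay squared throughout; the factors 2 in the inequalities derived from this
  identity replace the triangle inequality. The identity itself gives the Cauchy property of a
  minimizing sequence in the ergodic theorem.\<close>

lemma L2_parallelogram:
  assumes "f \<in> L2 m" "g \<in> L2 m"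
  shows "L2_inner m (\<lambda>x. f x + g x) (\<lambda>x. f x + g x) + L2_inner m (\<lambda>x. f x - g x) (\<lambda>x. f x - g x)
    = 2 * L2_inner m f f + 2 * L2_inner m g g"
  using assms by (simp add: L2_inner_simps L2_inner_commute[of m g f])

lemma L2_inner_sum_le:
  assumes "f \<in> L2 m" "g \<in> L2 m"
  shows "L2_inner m (\<lambda>x. f x + g x) (\<lambda>x. f x + g x) \<le> 2 * L2_inner m f f + 2 * L2_inner m g g"
  using L2_parallelogram[OF assms] L2_inner_self_nonneg[of m "\<lambda>x. f x - g x"] by linarith

lemma L2_inner_diff_le:
  assumes "f \<in> L2 m" "g \<in> L2 m"
  shows "L2_inner m (\<lambda>x. f x - g x) (\<lambda>x. f x - g x) \<le> 2 * L2_inner m f f + 2 * L2_inner m g g"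
  using L2_parallelogram[OF assms] L2_inner_self_nonneg[of m "\<lambda>x. f x + g x"] by linarith

lemma L2_inner_le:
  assumes "f \<in> L2 m" "g \<in> L2 m"
  shows "2 * L2_inner m f g \<le> L2_inner m f f + L2_inner m g g"
  using L2_inner_self_nonneg[of m "\<lambda>x. f x - g x"] assms
  by (simp add: L2_inner_simps L2_inner_commute[of m g f])

lemma (in finite_measure) bounded_L2:
  assumes "f \<in> borel_measurable M" "\<And>x. x \<in> space M \<Longrightarrow> \<bar>f x\<bar> \<le> B"
  shows "f \<in> L2 M"
proof -
  have "AE x in M. norm ((f x)\<^sup>2) \<le> B\<^sup>2"
    using assms(2) by (intro AE_I2) (auto simp: abs_le_square_iff[symmetric] intro: order_trans[OF _ abs_ge_self])
  then have "integrable M (\<lambda>x. (f x)\<^sup>2)"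
    using assms(1) by (intro integrable_const_bound) auto
  then show ?thesis
    using assms(1) by (simp add: L2_def)
qed

lemma (in finite_measure) const_L2: "(\<lambda>_. c) \<in> L2 M"
  by (rule bounded_L2[where B = "\<bar>c\<bar>"]) auto

lemma (in finite_measure) indicator_L2: "A \<in> sets M \<Longrightarrow> (indicator A :: 'a \<Rightarrow> real) \<in> L2 M"
  by (rule bounded_L2[where B = 1]) (auto simp: indicator_def)

lemma (in finite_measure) L2_integrable: "f \<in> L2 M \<Longrightarrow> integrable M f"
  using L2_integrable_mult[OF _ const_L2[of 1], of f] by simp

text \<open>The constant is the infimum of the levels that bound \<open>u\<close> from above almost
  everywhere; thresholds at distance 1/(n+1) on both sides squeeze \<open>u\<close> onto it.\<close>

lemma ae_constantI_thresholds:
  fixes u :: "'a \<Rightarrow> real"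
  assumes u: "u \<in> borel_measurable m"
    and thr: "\<And>c. (AE x in m. u x > c) \<or> (AE x in m. u x \<le> c)"
  shows "ae_constant m u"
proof -
  define S where "S = {c. AE x in m. u x \<le> c}"
  consider "S = {}" | "S \<noteq> {}" "\<not> bdd_below S" | "S \<noteq> {}" "bdd_below S"
    by metis
  then show ?thesis
  proof cases
    case 1
    then have "AE x in m. u x > real n" for n :: nat
      using thr[of "real n"] unfolding S_def by blast
    then have "AE x in m. \<forall>n::nat. u x > real n"
      by (simp add: AE_all_countable)
    \<comment> \<open>Here and in the next case \<open>u\<close> would be infinite almost
      everywhere. Then \<open>m\<close> is the null measure and any constant will do.\<close>
    then have "AE x in m. False"
    proof eventually_elim
      case (elim x)
      then show ?case
        using reals_Archimedean2[of "u x"] by (meson less_asym)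
    qed
    then have "AE x in m. u x = 0"
      by eventually_elim simp
    then show ?thesis
      unfolding ae_constant_def by blast
  next
    case 2
    have "AE x in m. u x \<le> - real n" for n :: nat
    proof -
      obtain c where "c \<in> S" "c < - real n"
        using 2(2) by (auto simp: bdd_below_def not_le)
      then show ?thesis
        by (auto simp: S_def elim!: AE_mp)
    qed
    then have "AE x in m. \<forall>n::nat. u x \<le> - real n"
      by (simp add: AE_all_countable)
    then have "AE x in m. False"
    proof eventually_elim
      case (elim x)
      then show ?case
        using reals_Archimedean2[of "- u x"] by (meson le_minus_iff not_less)
    qed
    then have "AE x in m. u x = 0"
      by eventually_elim simp
    then show ?thesis
      unfolding ae_constant_def by blast
  next
    case 3
    define c where "c = Inf S"
    have "AE x in m. u x \<le> c + 1 / real (Suc n)" for n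
    proof -
      have "Inf S < c + 1 / real (Suc n)"
        by (simp add: c_def)
      then obtain d where "d \<in> S" "d < c + 1 / real (Suc n)"
        using cInf_lessD[OF 3(1)] by blast
      then show ?thesis
        by (auto simp: S_def elim!: AE_mp)
    qed
    moreover have "AE x in m. u x > c - 1 / real (Suc n)" for n
    proof -
      have "c - 1 / real (Suc n) < Inf S"
        by (simp add: c_def)
      then have "c - 1 / real (Suc n) \<notin> S"
        using cInf_lower[OF _ 3(2)] by (meson not_le)
      then show ?thesis
        using thr[of "c - 1 / real (Suc n)"] by (auto simp: S_def)
    qed
    ultimately have "AE x in m. \<forall>n. \<bar>u x - c\<bar> \<le> 1 / real (Suc n)"
      unfolding AE_all_countable
    proof (intro allI)
      fix n
      assume a: "\<And>n. AE x in m. u x \<le> c + 1 / real (Suc n)"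
        and b: "\<And>n. AE x in m. c - 1 / real (Suc n) < u x"
      show "AE x in m. \<bar>u x - c\<bar> \<le> 1 / real (Suc n)"
        using a[of n] b[of n] by eventually_elim linarith
    qed
    then have "AE x in m. u x = c"
    proof eventually_elim
      case (elim x)
      show ?case
      proof (rule ccontr)
        assume "u x \<noteq> c"
        then obtain n where "inverse (real (Suc n)) < \<bar>u x - c\<bar>"
          using reals_Archimedean[of "\<bar>u x - c\<bar>"] by auto
        then show False
          using elim[rule_format, of n] by (simp add: inverse_eq_divide)
      qed
    qed
    then show ?thesis
      unfolding ae_constant_def by blast
  qed
qed

text \<open>A value other than 0 and 1 is possible only for a null measure; the second case absorbs
  it, since it uses no more than \<open>c \<noteq> 1\<close>.\<close>

lemma AE_indicator_const:
  assumes "B \<in> sets m" "AE x in m. (indicator B x :: real) = c"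
  shows "emeasure m (space m - B) = 0 \<or> emeasure m B = 0"
proof (cases "c = 1")
  case True
  have "AE x in m. x \<notin> space m - B"
    using assms(2) by eventually_elim (auto simp: True indicator_def split: if_splits)
  then show ?thesis
    using assms(1) by (subst (asm) AE_iff_null_sets[symmetric]) auto
next
  case False
  have "AE x in m. x \<notin> B"
    using assms(2) by eventually_elim (use False in \<open>auto simp: indicator_def split: if_splits\<close>)
  then show ?thesis
    using assms(1) by (subst (asm) AE_iff_null_sets[symmetric]) auto
qed

lemma tendsto_0_le_at_right:
  fixes f g :: "real \<Rightarrow> real"
  assumes "(g \<longlongrightarrow> 0) (at_right 0)" "\<And>\<alpha>. \<alpha> > 0 \<Longrightarrow> 0 \<le> f \<alpha>" "\<And>\<alpha>. \<alpha> > 0 \<Longrightarrow> f \<alpha> \<le> g \<alpha>"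
  shows "(f \<longlongrightarrow> 0) (at_right 0)"
  by (rule tendsto_sandwich[OF _ _ tendsto_const assms(1)])
    (use assms(2,3) in \<open>auto simp: eventually_at_filter\<close>)

section \<open>Forms and their resolvents\<close>

context coercive_closed_form
begin

lemma D_L2: "u \<in> D \<Longrightarrow> u \<in> L2 m"
  using D_subset by blast

lemma D_diff: "u \<in> D \<Longrightarrow> v \<in> D \<Longrightarrow> (\<lambda>x. u x - v x) \<in> D"
  using D_add[OF _ D_scale[of v "-1"]] by simp

lemma form_diff_left:
  "u \<in> D \<Longrightarrow> v \<in> D \<Longrightarrow> w \<in> D \<Longrightarrow> \<E> (\<lambda>x. u x - v x) w = \<E> u w - \<E> v w"
  using form_add_left[OF _ D_scale[of v "-1"]] form_scale_left[of v w "-1"] by simp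

lemma form_diff_right:
  "u \<in> D \<Longrightarrow> v \<in> D \<Longrightarrow> w \<in> D \<Longrightarrow> \<E> w (\<lambda>x. u x - v x) = \<E> w u - \<E> w v"
  using form_add_right[OF _ D_scale[of v "-1"]] form_scale_right[of v w "-1"] by simp

lemmas form_simps = form_add_left form_add_right form_scale_left form_scale_right
  form_diff_left form_diff_right D_add D_diff D_scale D_zero

lemma form_zero_left: "u \<in> D \<Longrightarrow> \<E> (\<lambda>x. 0) u = 0"
  using form_scale_left[of u u 0] by simp

text \<open>The parallelogram identity holds without symmetry, as the mixed terms cancel; the
  discarded term is the energy of \<open>u + v\<close>.\<close>

lemma form_diff_le:
  assumes "u \<in> D" "v \<in> D"
  shows "\<E> (\<lambda>x. u x - v x) (\<lambda>x. u x - v x) \<le> 2 * \<E> u u + 2 * \<E> v v"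
  using nonneg[of "\<lambda>x. u x + v x"] assms by (simp add: form_simps)

lemma form_shift_self_eq_0:
  assumes "\<alpha> > 0" "u \<in> D" "form_shift m \<E> \<alpha> u u = 0"
  shows "AE x in m. u x = 0"
proof -
  have "\<E> u u + \<alpha> * L2_inner m u u = 0"
    using assms(3) by (simp add: form_shift_def)
  moreover have "\<E> u u \<ge> 0" "\<alpha> * L2_inner m u u \<ge> 0"
    using assms nonneg[of u] L2_inner_self_nonneg[of m u] by auto
  ultimately have "\<alpha> * L2_inner m u u = 0"
    by linarith
  then show ?thesis
    using assms D_L2 L2_inner_self_eq_0 by fastforce
qed

text \<open>By Pythagoras no element of \<open>D\<close> is closer to \<open>f\<close> than 0 is,
  while density provides elements arbitrarily close to \<open>f\<close>.\<close>

lemma orthogonal_to_D: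
  assumes f: "f \<in> L2 m" and orth: "\<And>v. v \<in> D \<Longrightarrow> L2_inner m f v = 0"
  shows "AE x in m. f x = 0"
proof -
  have "L2_inner m f f \<le> 0"
  proof (rule field_le_epsilon)
    fix e :: real assume "0 < e"
    then obtain v where v: "v \<in> D" "(\<integral>x. (f x - v x)\<^sup>2 \<partial>m) < e"
      using dense[OF f] by blast
    have "L2_inner m (\<lambda>x. f x - v x) (\<lambda>x. f x - v x) = L2_inner m f f + L2_inner m v v"
      using f v(1) D_L2 orth[OF v(1)] by (simp add: L2_inner_simps L2_inner_commute[of m v f])
    moreover have "L2_inner m (\<lambda>x. f x - v x) (\<lambda>x. f x - v x) < e"
      using v(2) by (simp add: L2_inner_def power2_eq_square)
    ultimately show "L2_inner m f f \<le> 0 + e"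
      using L2_inner_self_nonneg[of m v] by linarith
  qed
  then show ?thesis
    using L2_inner_self_nonneg[of m f] L2_inner_self_eq_0[OF f] by linarith
qed

text \<open>
  A sequence whose energy tends to 0 converges in the energy norm as soon as it is Cauchy in
  \<open>L\<^sup>2\<close>; this replaces the usual weak compactness argument.
\<close>

lemma energy_null_Cauchy:
  fixes v :: "nat \<Rightarrow> 'a \<Rightarrow> real"
  assumes D: "\<And>n. v n \<in> D"
    and null: "(\<lambda>n. \<E> (v n) (v n)) \<longlonglongrightarrow> 0"
    and Cauchy: "\<And>\<epsilon>. \<epsilon> > 0 \<Longrightarrow> \<exists>N. \<forall>i\<ge>N. \<forall>j\<ge>N.
      L2_inner m (\<lambda>x. v i x - v j x) (\<lambda>x. v i x - v j x) < \<epsilon>"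
  obtains w where "w \<in> D" "\<E> w w = 0"
    "(\<lambda>n. L2_inner m (\<lambda>x. v n x - w x) (\<lambda>x. v n x - w x)) \<longlonglongrightarrow> 0"
proof -
  have sym: "form_shift m (sym_part \<E>) 1 u u = \<E> u u + L2_inner m u u" for u
    by (simp add: form_shift_def sym_part_def)
  have "\<exists>w\<in>D. (\<lambda>n. form_shift m (sym_part \<E>) 1 (\<lambda>x. v n x - w x) (\<lambda>x. v n x - w x)) \<longlonglongrightarrow> 0"
  proof (rule closed[OF D])
    fix e :: real assume e: "e > 0"
    then obtain N1 where N1: "\<And>i j. i \<ge> N1 \<Longrightarrow> j \<ge> N1 \<Longrightarrow>
        L2_inner m (\<lambda>x. v i x - v j x) (\<lambda>x. v i x - v j x) < e / 2"
      using Cauchy[of "e / 2"] by auto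
    have "\<forall>\<^sub>F n in sequentially. \<E> (v n) (v n) < e / 8"
      using order_tendstoD(2)[OF null, of "e / 8"] e by simp
    \<comment> \<open>\<open>form_diff_le\<close> doubles each energy, so \<open>e / 8\<close>
      amounts to \<open>e / 2\<close> for the energy part, next to \<open>e / 2\<close> for the norm
      part.\<close>
    then obtain N2 where N2: "\<And>i. i \<ge> N2 \<Longrightarrow> \<E> (v i) (v i) < e / 8"
      by (auto simp: eventually_sequentially)
    show "\<exists>N. \<forall>i\<ge>N. \<forall>j\<ge>N.
        form_shift m (sym_part \<E>) 1 (\<lambda>x. v i x - v j x) (\<lambda>x. v i x - v j x) < e"
    proof (intro exI[of _ "max N1 N2"] allI impI)
      fix i j assume "i \<ge> max N1 N2" "j \<ge> max N1 N2"
      then show "form_shift m (sym_part \<E>) 1 (\<lambda>x. v i x - v j x) (\<lambda>x. v i x - v j x) < e"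
        using N1[of i j] N2[of i] N2[of j] form_diff_le[OF D[of i] D[of j]] unfolding sym by simp
    qed
  qed
  then obtain w where w: "w \<in> D"
    and lim: "(\<lambda>n. \<E> (\<lambda>x. v n x - w x) (\<lambda>x. v n x - w x)
      + L2_inner m (\<lambda>x. v n x - w x) (\<lambda>x. v n x - w x)) \<longlonglongrightarrow> 0"
    unfolding sym by blast
  have E0: "(\<lambda>n. \<E> (\<lambda>x. v n x - w x) (\<lambda>x. v n x - w x)) \<longlonglongrightarrow> 0"
    using D w by (intro tendsto_sandwich[OF _ _ tendsto_const lim] always_eventually)
      (simp_all add: D_diff nonneg L2_inner_self_nonneg)
  have L0: "(\<lambda>n. L2_inner m (\<lambda>x. v n x - w x) (\<lambda>x. v n x - w x)) \<longlonglongrightarrow> 0"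
    using D w by (intro tendsto_sandwich[OF _ _ tendsto_const lim] always_eventually)
      (simp_all add: D_diff nonneg L2_inner_self_nonneg)
  \<comment> \<open>\<open>w\<close> is the difference of \<open>v n\<close> and
    \<open>v n - w\<close>, whose energies both tend to 0.\<close>
  have "\<E> w w \<le> 2 * \<E> (v n) (v n) + 2 * \<E> (\<lambda>x. v n x - w x) (\<lambda>x. v n x - w x)" for n
    using form_diff_le[OF D[of n] D_diff[OF D[of n] w]] by simp
  moreover have "(\<lambda>n. 2 * \<E> (v n) (v n) + 2 * \<E> (\<lambda>x. v n x - w x) (\<lambda>x. v n x - w x))
      \<longlonglongrightarrow> 2 * 0 + 2 * 0"
    by (intro tendsto_intros null E0)
  ultimately have "\<E> w w \<le> 0"
    by (intro LIMSEQ_le_const) auto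
  then show ?thesis
    using that w nonneg[OF w] L0 by force
qed

text \<open>The limit from \<open>energy_null_Cauchy\<close> is also the limit in the mean square,
  hence equals \<open>g\<close> almost everywhere, and \<open>D\<close> and \<open>\<E>\<close> only
  see classes. This is how 1 and the indicators of superlevel sets are placed in
  \<open>D\<close>.\<close>

lemma energy_null_limit:
  fixes v :: "nat \<Rightarrow> 'a \<Rightarrow> real"
  assumes D: "\<And>n. v n \<in> D"
    and null: "(\<lambda>n. \<E> (v n) (v n)) \<longlonglongrightarrow> 0"
    and g: "g \<in> L2 m"
    and lim: "(\<lambda>n. L2_inner m (\<lambda>x. v n x - g x) (\<lambda>x. v n x - g x)) \<longlonglongrightarrow> 0"
  shows "g \<in> D \<and> \<E> g g = 0"
proof -
  have "\<exists>N. \<forall>i\<ge>N. \<forall>j\<ge>N. L2_inner m (\<lambda>x. v i x - v j x) (\<lambda>x. v i x - v j x) < e"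
    if e: "e > 0" for e
  proof -
    obtain N where N: "\<And>i. i \<ge> N \<Longrightarrow> L2_inner m (\<lambda>x. v i x - g x) (\<lambda>x. v i x - g x) < e / 4"
      using order_tendstoD(2)[OF lim, of "e / 4"] e by (auto simp: eventually_sequentially)
    show ?thesis
    proof (intro exI[of _ N] allI impI)
      fix i j assume "i \<ge> N" "j \<ge> N"
      then show "L2_inner m (\<lambda>x. v i x - v j x) (\<lambda>x. v i x - v j x) < e"
        using N[of i] N[of j] L2_inner_diff_le[of "\<lambda>x. v i x - g x" m "\<lambda>x. v j x - g x"] D D_L2 g
        by (simp add: L2_diff)
    qed
  qed
  then obtain w where w: "w \<in> D" "\<E> w w = 0"
    and wlim: "(\<lambda>n. L2_inner m (\<lambda>x. v n x - w x) (\<lambda>x. v n x - w x)) \<longlonglongrightarrow> 0"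
    using energy_null_Cauchy[OF D null] by blast
  have "L2_inner m (\<lambda>x. w x - g x) (\<lambda>x. w x - g x)
      \<le> 2 * L2_inner m (\<lambda>x. v n x - g x) (\<lambda>x. v n x - g x)
        + 2 * L2_inner m (\<lambda>x. v n x - w x) (\<lambda>x. v n x - w x)" for n
    using L2_inner_diff_le[of "\<lambda>x. v n x - g x" m "\<lambda>x. v n x - w x"] D D_L2 g w(1)
    by (simp add: L2_diff)
  moreover have "(\<lambda>n. 2 * L2_inner m (\<lambda>x. v n x - g x) (\<lambda>x. v n x - g x)
        + 2 * L2_inner m (\<lambda>x. v n x - w x) (\<lambda>x. v n x - w x)) \<longlonglongrightarrow> 2 * 0 + 2 * 0"
    by (intro tendsto_intros lim wlim)
  ultimately have "L2_inner m (\<lambda>x. w x - g x) (\<lambda>x. w x - g x) \<le> 0"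
    by (intro LIMSEQ_le_const) auto
  then have "AE x in m. w x - g x = 0"
    using L2_inner_self_eq_0[of "\<lambda>x. w x - g x" m] L2_inner_self_nonneg[of m "\<lambda>x. w x - g x"]
      D_L2[OF w(1)] g by (simp add: L2_diff)
  then have ae: "AE x in m. w x = g x"
    by auto
  then have "g \<in> D"
    using D_cong[OF w(1)] g L2_measurable by blast
  moreover have "\<E> g g = \<E> w w"
    using form_cong[OF w(1) \<open>g \<in> D\<close> w(1) ae] form_cong[OF w(1) \<open>g \<in> D\<close> \<open>g \<in> D\<close> ae] by simp
  ultimately show ?thesis
    using w(2) by simp
qed

end

section \<open>The unit contraction\<close>

context dirichlet_form
begin

text \<open>
  Adding a small multiple of \<open>u - c u\<close> to \<open>c u\<close>, where \<open>c\<close> is the unit contraction, does not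
  change the contraction, so the quadratic term in the contraction inequality can be made
  negligible.
\<close>

lemma unit_contraction_perturb:
  assumes "0 \<le> \<epsilon>"
  shows "unit_contraction (\<lambda>x. unit_contraction u x + \<epsilon> * (u x - unit_contraction u x))
    = unit_contraction u"
proof (rule ext)
  fix x
  consider "u x \<le> 0" | "0 \<le> u x" "u x \<le> 1" | "1 \<le> u x"
    by linarith
  then show "unit_contraction (\<lambda>x. unit_contraction u x + \<epsilon> * (u x - unit_contraction u x)) x
      = unit_contraction u x"
  proof cases
    case 1
    then have "\<epsilon> * u x \<le> 0"
      using assms by (simp add: mult_nonneg_nonpos)
    then show ?thesis
      using 1 by (simp add: unit_contraction_def)
  next
    case 3
    then have "\<epsilon> * (u x - 1) \<ge> 0"
      using assms by simp
    then show ?thesis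
      using 3 by (simp add: unit_contraction_def)
  qed (simp add: unit_contraction_def)
qed

text \<open>The energy of \<open>u\<close> is absent from the bound. For a multiple of a resolvent
  image, or for \<open>u\<close> of energy 0, the pairing on the right is explicit, and this
  controls the truncation.\<close>

lemma form_contraction_le:
  assumes u: "u \<in> D"
  shows "\<E> (unit_contraction u) (unit_contraction u) \<le> \<E> u (unit_contraction u)"
proof -
  define c where "c = unit_contraction u"
  define w where "w = (\<lambda>x. u x - c x)"
  have c: "c \<in> D" and w: "w \<in> D"
    using u contraction_mem D_diff by (auto simp: c_def w_def)
  have pos: "0 \<le> 2 * \<E> w c + \<epsilon> * \<E> w w" if e: "\<epsilon> > 0" for \<epsilon>
  proof -
    let ?v = "\<lambda>x. c x + \<epsilon> * w x"
    have v: "?v \<in> D" and cv: "unit_contraction ?v = c"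
      using c w e unit_contraction_perturb[of \<epsilon> u] by (auto simp: c_def w_def D_add D_scale)
    have "0 \<le> \<E> (\<lambda>x. ?v x - c x) (\<lambda>x. ?v x + c x)"
      using contraction_right[OF v] by (simp only: cv)
    also have "\<dots> = \<E> (\<lambda>x. \<epsilon> * w x) (\<lambda>x. 2 * c x + \<epsilon> * w x)"
      by (simp add: algebra_simps)
    also have "\<dots> = \<epsilon> * (2 * \<E> w c + \<epsilon> * \<E> w w)"
      using c w by (simp add: form_simps distrib_left)
    finally show ?thesis
      using e by (simp add: zero_le_mult_iff)
  qed
  have "0 \<le> 2 * \<E> w c"
  proof (rule field_le_epsilon)
    fix e :: real assume e: "e > 0"
    \<comment> \<open>The \<open>+ 1\<close> covers energy 0 and still gives
      \<open>\<epsilon> * \<E> w w \<le> e\<close>.\<close>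
    define \<epsilon> where "\<epsilon> = e / (\<E> w w + 1)"
    have "\<E> w w \<ge> 0"
      using nonneg w by blast
    then have "\<epsilon> > 0" "\<epsilon> * \<E> w w \<le> e"
      using e by (auto simp: \<epsilon>_def field_simps)
    then show "0 \<le> 2 * \<E> w c + e"
      using pos[of \<epsilon>] by linarith
  qed
  then show ?thesis
    using u c by (simp add: w_def form_diff_left flip: c_def)
qed

text \<open>Adding the two contraction inequalities cancels the mixed terms. For the symmetric part
  this is all that either of them says.\<close>

lemma form_contraction_self_le:
  assumes u: "u \<in> D"
  shows "\<E> (unit_contraction u) (unit_contraction u) \<le> \<E> u u"
  using contraction_left[OF u] contraction_right[OF u] u contraction_mem[OF u]
  by (simp add: form_simps)

end

section \<open>Kernels and potentials\<close>

context sub_markov_resolvent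
begin

lemma kernel_space: "\<alpha> > 0 \<Longrightarrow> x \<in> space m \<Longrightarrow> space (U \<alpha> x) = space m"
  using sets_kernel sets_eq_imp_space_eq by blast

lemma kernel_finite: "\<alpha> > 0 \<Longrightarrow> x \<in> space m \<Longrightarrow> finite_measure (U \<alpha> x)"
proof (rule finite_measureI)
  assume a: "\<alpha> > 0" "x \<in> space m"
  show "emeasure (U \<alpha> x) (space (U \<alpha> x)) \<noteq> \<infinity>"
    using sub_markov[OF a] a(1) unfolding kernel_space[OF a]
    by (auto simp: ennreal_mult_top top_unique)
qed

lemma kernel_mass_le:
  assumes "\<alpha> > 0" "x \<in> space m"
  shows "measure (U \<alpha> x) (space m) \<le> 1 / \<alpha>"
proof -
  interpret K: finite_measure "U \<alpha> x"
    by (rule kernel_finite[OF assms])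
  have "ennreal (\<alpha> * measure (U \<alpha> x) (space m)) \<le> ennreal 1"
    using sub_markov[OF assms] assms(1) by (simp add: ennreal_mult K.emeasure_eq_measure)
  then show ?thesis
    using assms(1) by (simp add: field_simps)
qed

text \<open>For \<alpha> \<le> \<beta> the right side of the resolvent equation is nonnegative on
  every set. Hence \<open>potential\<close> is a monotone limit as \<alpha> decreases to 0.\<close>

lemma kernel_antimono:
  assumes "0 < \<alpha>" "\<alpha> \<le> \<beta>" "x \<in> space m"
  shows "U \<beta> x \<le> U \<alpha> x"
proof -
  interpret a: finite_measure "U \<alpha> x"
    using kernel_finite assms by simp
  interpret b: finite_measure "U \<beta> x"
    using kernel_finite assms by simp
  have "emeasure (U \<beta> x) A \<le> emeasure (U \<alpha> x) A" if A: "A \<in> sets m" for A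
  proof -
    have "0 \<le> (\<beta> - \<alpha>) * (\<integral>y. measure (U \<beta> y) A \<partial>U \<alpha> x)"
      using assms by (intro mult_nonneg_nonneg Bochner_Integration.integral_nonneg) auto
    then have "measure (U \<beta> x) A \<le> measure (U \<alpha> x) A"
      using resolvent_equation[OF assms(1) _ assms(3) A, of \<beta>] assms by linarith
    then show ?thesis
      by (simp add: a.emeasure_eq_measure b.emeasure_eq_measure)
  qed
  then show ?thesis
    using assms by (simp add: le_measure sets_kernel le_fun_def emeasure_notin_sets)
qed

lemma nn_kernel_antimono:
  assumes "0 < \<alpha>" "\<alpha> \<le> \<beta>" "x \<in> space m"
  shows "(\<integral>\<^sup>+y. f y \<partial>U \<beta> x) \<le> (\<integral>\<^sup>+y. f y \<partial>U \<alpha> x)"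
  using assms by (intro nn_integral_mono_measure kernel_antimono) (simp_all add: sets_kernel)

lemma kernel_measurable:
  "\<alpha> > 0 \<Longrightarrow> x \<in> space m \<Longrightarrow> f \<in> measurable m N \<Longrightarrow> f \<in> measurable (U \<alpha> x) N"
  using measurable_cong_sets[OF sets_kernel refl] by blast

lemma kernel_integrable:
  assumes "\<alpha> > 0" "x \<in> space m" "f \<in> borel_measurable m" "\<And>y. y \<in> space m \<Longrightarrow> \<bar>f y\<bar> \<le> (B :: real)"
  shows "integrable (U \<alpha> x) f"
proof -
  interpret finite_measure "U \<alpha> x"
    by (rule kernel_finite[OF assms(1,2)])
  show ?thesis
    using assms(4) kernel_space[OF assms(1,2)]
    by (intro integrable_const_bound[of _ B] kernel_measurable[OF assms(1-3)]) (auto intro!: AE_I2)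
qed

lemma nn_kernel_eq:
  assumes "\<alpha> > 0" "x \<in> space m" "f \<in> borel_measurable m"
    "\<And>y. y \<in> space m \<Longrightarrow> 0 \<le> f y" "\<And>y. y \<in> space m \<Longrightarrow> f y \<le> (B :: real)"
  shows "(\<integral>\<^sup>+y. ennreal (f y) \<partial>U \<alpha> x) = ennreal (kernel_op U \<alpha> f x)"
  unfolding kernel_op_def using assms kernel_space[OF assms(1,2)]
  by (intro nn_integral_eq_integral kernel_integrable[OF assms(1-3), of B] AE_I2)
     (auto simp: abs_le_iff intro: order_trans[of _ 0])

lemma kernel_op_nonneg:
  assumes "\<alpha> > 0" "x \<in> space m" "\<And>y. y \<in> space m \<Longrightarrow> 0 \<le> f y"
  shows "0 \<le> kernel_op U \<alpha> f x"
  unfolding kernel_op_def using assms kernel_space[OF assms(1,2)]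
  by (intro Bochner_Integration.integral_nonneg) auto

lemma kernel_op_le:
  assumes "\<alpha> > 0" "x \<in> space m" "f \<in> borel_measurable m"
    "\<And>y. y \<in> space m \<Longrightarrow> 0 \<le> f y" "\<And>y. y \<in> space m \<Longrightarrow> f y \<le> B"
  shows "kernel_op U \<alpha> f x \<le> B / \<alpha>"
proof -
  interpret finite_measure "U \<alpha> x"
    by (rule kernel_finite[OF assms(1,2)])
  have B: "0 \<le> B"
    using assms(2,4,5) order_trans by blast
  have "kernel_op U \<alpha> f x \<le> (\<integral>y. B \<partial>U \<alpha> x)"
    unfolding kernel_op_def using assms kernel_space[OF assms(1,2)] B
    by (intro integral_mono kernel_integrable[OF assms(1-3), of B]) auto
  also have "\<dots> = B * measure (U \<alpha> x) (space m)"
    using kernel_space[OF assms(1,2)] by simp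
  also have "\<dots> \<le> B * (1 / \<alpha>)"
    using kernel_mass_le[OF assms(1,2)] B by (rule mult_left_mono)
  finally show ?thesis
    by simp
qed

lemma nn_kernel_measurable:
  assumes "f \<in> borel_measurable m" "\<alpha> > 0"
  shows "(\<lambda>x. \<integral>\<^sup>+y. f y \<partial>U \<alpha> x) \<in> borel_measurable m"
  using assms(1)
proof (induction rule: borel_measurable_induct)
  case (cong f g)
  have "(\<integral>\<^sup>+y. f y \<partial>U \<alpha> x) = (\<integral>\<^sup>+y. g y \<partial>U \<alpha> x)" if "x \<in> space m" for x
    using cong(3) kernel_space[OF assms(2) that] by (intro nn_integral_cong) auto
  then show ?case
    using cong(4) by (simp cong: measurable_cong)
next
  case (set A)
  have "(\<integral>\<^sup>+y. indicator A y \<partial>U \<alpha> x) = emeasure (U \<alpha> x) A" if "x \<in> space m" for x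
    using set sets_kernel[OF assms(2) that] by simp
  then show ?case
    using measurable_kernel[OF assms(2) set] by (simp cong: measurable_cong)
next
  case (mult u c)
  have "(\<integral>\<^sup>+y. c * u y \<partial>U \<alpha> x) = c * (\<integral>\<^sup>+y. u y \<partial>U \<alpha> x)" if "x \<in> space m" for x
    using mult kernel_measurable[OF assms(2) that] by (intro nn_integral_cmult) auto
  then show ?case
    using mult by (simp cong: measurable_cong)
next
  case (add u v)
  have "(\<integral>\<^sup>+y. v y + u y \<partial>U \<alpha> x) = (\<integral>\<^sup>+y. v y \<partial>U \<alpha> x) + (\<integral>\<^sup>+y. u y \<partial>U \<alpha> x)"
    if "x \<in> space m" for x
    using add by (intro nn_integral_add kernel_measurable[OF assms(2) that]) auto
  then show ?case
    using add by (simp cong: measurable_cong)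
next
  case (seq V)
  have "(\<integral>\<^sup>+y. (SUP i. V i) y \<partial>U \<alpha> x) = (SUP i. \<integral>\<^sup>+y. V i y \<partial>U \<alpha> x)" if "x \<in> space m" for x
    unfolding SUP_apply using seq
    by (intro nn_integral_monotone_convergence_SUP kernel_measurable[OF assms(2) that]) auto
  then show ?case
    using seq by (simp cong: measurable_cong)
qed

text \<open>Monotonicity in \<alpha> makes the values 1/(n+1) cofinal. Countability is what gives
  measurability of potentials and lets exceptional null sets be united.\<close>

lemma potential_eq_SUP:
  assumes "x \<in> space m"
  shows "potential U f x = (SUP n. \<integral>\<^sup>+y. f y \<partial>U (1 / real (Suc n)) x)"
  unfolding potential_def
proof (rule SUP_eq)
  fix \<alpha> :: real assume "\<alpha> \<in> {0<..}"
  then have a: "\<alpha> > 0" by simp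
  then obtain n where "inverse (real (Suc n)) < \<alpha>"
    using reals_Archimedean by blast
  then show "\<exists>n\<in>UNIV. (\<integral>\<^sup>+y. f y \<partial>U \<alpha> x) \<le> (\<integral>\<^sup>+y. f y \<partial>U (1 / real (Suc n)) x)"
    using nn_kernel_antimono[of "1 / real (Suc n)" \<alpha> x f] assms
    by (intro bexI[of _ n]) (auto simp: inverse_eq_divide)
next
  fix n :: nat
  show "\<exists>\<alpha>\<in>{0<..}. (\<integral>\<^sup>+y. f y \<partial>U (1 / real (Suc n)) x) \<le> (\<integral>\<^sup>+y. f y \<partial>U \<alpha> x)"
    by (intro bexI[of _ "1 / real (Suc n)"]) auto
qed

lemma potential_measurable:
  assumes "f \<in> borel_measurable m"
  shows "potential U f \<in> borel_measurable m"
proof -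
  have "(\<lambda>x. SUP n. \<integral>\<^sup>+y. f y \<partial>U (1 / real (Suc n)) x) \<in> borel_measurable m"
    using nn_kernel_measurable[OF assms] by (intro borel_measurable_SUP) auto
  then show ?thesis
    by (simp add: potential_eq_SUP cong: measurable_cong)
qed

lemma nn_kernel_incseq:
  "x \<in> space m \<Longrightarrow> incseq (\<lambda>n. \<integral>\<^sup>+y. f y \<partial>U (1 / real (Suc n)) x)"
  by (intro incseq_SucI nn_kernel_antimono) (auto simp: field_simps)

lemma kernel_op_indicator:
  assumes "\<alpha> > 0" "x \<in> space m" "B \<in> sets m"
  shows "kernel_op U \<alpha> (indicator B) x = measure (U \<alpha> x) B"
  using assms sets_kernel[OF assms(1,2)] sets.sets_into_space[of B "U \<alpha> x"]
  by (simp add: kernel_op_def Int_absorb2)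

lemma potential_indicator_eq_0:
  assumes "x \<in> space m" "B \<in> sets m"
  shows "potential U (indicator B) x = 0 \<longleftrightarrow> (\<forall>n. measure (U (1 / real (Suc n)) x) B = 0)"
proof -
  have "(\<integral>\<^sup>+y. indicator B y \<partial>U (1 / real (Suc n)) x) = ennreal (measure (U (1 / real (Suc n)) x) B)" for n
  proof -
    interpret K: finite_measure "U (1 / real (Suc n)) x"
      using assms(1) by (intro kernel_finite) simp_all
    show ?thesis
      using assms sets_kernel[of "1 / real (Suc n)" x]
      by (simp add: K.emeasure_eq_measure del: of_nat_Suc)
  qed
  then have "potential U (indicator B) x = 0 \<longleftrightarrow>
      (\<forall>n. ennreal (measure (U (1 / real (Suc n)) x) B) = 0)"
    by (simp add: potential_eq_SUP[OF assms(1)] bot_ennreal[symmetric])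
  then show ?thesis
    by (simp add: ennreal_eq_0_iff measure_le_0_iff)
qed

lemma potential_indicator_measure_0:
  assumes "\<alpha> > 0" "x \<in> space m" "B \<in> sets m" "potential U (indicator B) x = 0"
  shows "emeasure (U \<alpha> x) B = 0"
proof -
  have "emeasure (U \<alpha> x) B = (\<integral>\<^sup>+y. indicator B y \<partial>U \<alpha> x)"
    using assms(3) sets_kernel[OF assms(1,2)] by simp
  also have "\<dots> \<le> potential U (indicator B) x"
    unfolding potential_def using assms(1) by (intro SUP_upper) simp
  finally show ?thesis
    using assms(4) by simp
qed

end

section \<open>The resolvent determined by the form; the generator\<close>

locale form_resolvent =
  dirichlet_form m D \<E> + finite_measure m + sub_markov_resolvent m U
  for m :: "'a measure" and D :: "('a \<Rightarrow> real) set" and \<E> :: "'a form" and U :: "'a kernel_family" +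
  assumes sector: "strong_sector D \<E>"
    and kernel_op_D: "\<And>\<alpha> f. \<alpha> > 0 \<Longrightarrow> f \<in> L2 m \<Longrightarrow> kernel_op U \<alpha> f \<in> D"
    and kernel_op_form: "\<And>\<alpha> f v. \<alpha> > 0 \<Longrightarrow> f \<in> L2 m \<Longrightarrow> v \<in> D \<Longrightarrow>
      form_shift m \<E> \<alpha> (kernel_op U \<alpha> f) v = L2_inner m f v"
begin

lemma kernel_op_L2: "\<alpha> > 0 \<Longrightarrow> f \<in> L2 m \<Longrightarrow> kernel_op U \<alpha> f \<in> L2 m"
  using kernel_op_D D_L2 by blast

lemma kernel_op_scale: "kernel_op U \<alpha> (\<lambda>y. c * f y) x = c * kernel_op U \<alpha> f x"
  by (simp add: kernel_op_def)

lemma kernel_op_energy: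
  assumes "\<alpha> > 0" "f \<in> L2 m" "v \<in> D"
  shows "\<E> (kernel_op U \<alpha> f) v = L2_inner m f v - \<alpha> * L2_inner m (kernel_op U \<alpha> f) v"
  using kernel_op_form[OF assms] by (simp add: form_shift_def)

text \<open>The difference of two solutions, tested with itself, has shifted energy 0. The operator
  identities below are checked by testing against \<open>D\<close> and then read off from
  here.\<close>

lemma kernel_op_unique:
  assumes "\<alpha> > 0" "f \<in> L2 m" "u \<in> D"
    and eq: "\<And>v. v \<in> D \<Longrightarrow> \<E> u v + \<alpha> * L2_inner m u v = L2_inner m f v"
  shows "AE x in m. u x = kernel_op U \<alpha> f x"
proof -
  let ?w = "\<lambda>x. u x - kernel_op U \<alpha> f x"
  have w: "?w \<in> D"
    using assms kernel_op_D D_diff by blast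
  have "form_shift m \<E> \<alpha> ?w ?w = (\<E> u ?w + \<alpha> * L2_inner m u ?w)
      - form_shift m \<E> \<alpha> (kernel_op U \<alpha> f) ?w"
    using assms(1-3) w kernel_op_D D_L2
    by (simp add: form_shift_def form_diff_left L2_inner_diff_left right_diff_distrib)
  also have "\<dots> = 0"
    using eq[OF w] kernel_op_form[OF assms(1,2) w] by simp
  finally have "AE x in m. ?w x = 0"
    by (rule form_shift_self_eq_0[OF assms(1) w])
  then show ?thesis
    by auto
qed

lemma kernel_op_cong_AE:
  assumes "\<alpha> > 0" "f \<in> L2 m" "g \<in> L2 m" "AE x in m. f x = g x"
  shows "AE x in m. kernel_op U \<alpha> f x = kernel_op U \<alpha> g x"
proof (rule kernel_op_unique[OF assms(1,3) kernel_op_D[OF assms(1,2)]])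
  fix v assume v: "v \<in> D"
  have "L2_inner m f v = L2_inner m g v"
    using assms v D_L2 by (intro L2_inner_cong_AE) auto
  then show "\<E> (kernel_op U \<alpha> f) v + \<alpha> * L2_inner m (kernel_op U \<alpha> f) v = L2_inner m g v"
    using kernel_op_form[OF assms(1,2) v] by (simp add: form_shift_def)
qed

text \<open>Additivity of the Bochner integral would require integrability under
  \<open>U \<alpha> x\<close>, which may fail at some \<open>x\<close> for square integrable
  functions. The form supplies it almost everywhere instead.\<close>

lemma kernel_op_add:
  assumes "\<alpha> > 0" "f \<in> L2 m" "g \<in> L2 m"
  shows "AE x in m. kernel_op U \<alpha> f x + kernel_op U \<alpha> g x = kernel_op U \<alpha> (\<lambda>y. f y + g y) x"
  using assms
  by (intro kernel_op_unique)
     (simp_all add: L2_inner_simps form_simps kernel_op_D D_L2 kernel_op_energy algebra_simps)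

text \<open>Unlike \<open>resolvent_equation\<close>, which concerns measures of sets, this comes
  from the form: raising the shift from \<alpha> to \<beta> adds (\<beta> - \<alpha>) times the
  pairing with \<open>kernel_op U \<alpha> f\<close>.\<close>

lemma resolvent_L2:
  assumes "\<alpha> > 0" "\<beta> > 0" "f \<in> L2 m"
  shows "AE x in m. kernel_op U \<alpha> f x = kernel_op U \<beta> (\<lambda>y. f y + (\<beta> - \<alpha>) * kernel_op U \<alpha> f y) x"
  using assms
  by (intro kernel_op_unique)
     (simp_all add: L2_inner_simps kernel_op_D D_L2 kernel_op_energy algebra_simps)

text \<open>Write w for \<open>\<alpha> U\<^sub>\<alpha> f\<close>. Nonnegativity of the energy
  gives (w, w) \<le> (f, w), and 2 (f, w) \<le> (f, f) + (w, w).\<close>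

lemma kernel_op_contraction:
  assumes "\<alpha> > 0" "f \<in> L2 m"
  shows "L2_inner m (\<lambda>x. \<alpha> * kernel_op U \<alpha> f x) (\<lambda>x. \<alpha> * kernel_op U \<alpha> f x) \<le> L2_inner m f f"
proof -
  let ?k = "kernel_op U \<alpha> f"
  let ?w = "\<lambda>x. \<alpha> * ?k x"
  have k: "?k \<in> D"
    using assms kernel_op_D by blast
  have "0 \<le> \<alpha> * \<E> ?k ?k"
    using nonneg[OF k] assms(1) by simp
  also have "\<dots> = L2_inner m f ?w - L2_inner m ?w ?w"
    using assms k by (simp add: kernel_op_energy L2_inner_simps algebra_simps)
  finally show ?thesis
    using L2_inner_le[OF assms(2) L2_scale[OF D_L2[OF k], of \<alpha>]] by linarith
qed

lemma energy_null_form: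
  assumes "u \<in> D" "\<E> u u = 0" "v \<in> D"
  shows "\<E> u v = 0" "\<E> v u = 0"
proof -
  obtain k where k: "\<And>u v. u \<in> D \<Longrightarrow> v \<in> D \<Longrightarrow> \<bar>\<E> u v\<bar> \<le> k * sqrt (\<E> u u) * sqrt (\<E> v v)"
    using sector unfolding strong_sector_def by blast
  show "\<E> u v = 0" "\<E> v u = 0"
    using k[OF assms(1,3)] k[OF assms(3,1)] assms(2) by auto
qed

lemma energy_null_diff:
  assumes "u \<in> D" "\<E> u u = 0" "v \<in> D" "\<E> v v = 0"
  shows "\<E> (\<lambda>x. u x - v x) (\<lambda>x. u x - v x) = 0"
  using form_diff_le[OF assms(1,3)] nonneg[OF D_diff[OF assms(1,3)]] assms(2,4) by simp

text \<open>As \<open>\<E> u\<close> vanishes on \<open>D\<close>, \<open>u\<close> itself solves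
  the equation that determines the resolvent at the datum \<open>\<alpha> * u\<close>.\<close>

lemma energy_null_fixed:
  assumes "\<alpha> > 0" "u \<in> D" "\<E> u u = 0"
  shows "AE x in m. \<alpha> * kernel_op U \<alpha> u x = u x"
proof -
  have "AE x in m. u x = kernel_op U \<alpha> (\<lambda>y. \<alpha> * u y) x"
    using assms by (intro kernel_op_unique) (simp_all add: energy_null_form(1)[OF assms(2,3)] L2_inner_simps D_L2)
  then show ?thesis
    unfolding kernel_op_scale by eventually_elim simp
qed

text \<open>Substituting the fixed point relation in the first argument turns the energy into a
  multiple of \<open>(u, u) - (\<alpha> U\<^sub>\<alpha> u, u)\<close>, which is 0. A single
  \<alpha> is enough.\<close>

lemma fixed_energy_null:
  assumes "\<alpha> > 0" "u \<in> L2 m" and fixed: "AE x in m. \<alpha> * kernel_op U \<alpha> u x = u x"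
  shows "u \<in> D" "\<E> u u = 0"
proof -
  have k: "(\<lambda>x. \<alpha> * kernel_op U \<alpha> u x) \<in> D"
    using assms kernel_op_D D_scale by blast
  show u: "u \<in> D"
    using D_cong[OF k _ fixed] assms(2) L2_measurable by blast
  have "\<E> u u = \<E> (\<lambda>x. \<alpha> * kernel_op U \<alpha> u x) u"
    using form_cong[OF k u u fixed] by simp
  also have "\<dots> = \<alpha> * (L2_inner m u u - L2_inner m (\<lambda>x. \<alpha> * kernel_op U \<alpha> u x) u)"
    using assms u by (simp add: form_scale_left kernel_op_D kernel_op_energy L2_inner_scale_left)
  also have "L2_inner m (\<lambda>x. \<alpha> * kernel_op U \<alpha> u x) u = L2_inner m u u"
    using fixed k u D_L2 by (intro L2_inner_cong_AE) auto
  finally show "\<E> u u = 0"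
    by simp
qed

text \<open>The weak form of the generator is free of \<alpha>, so statements about the graph reduce
  to statements about \<open>\<E>\<close>.\<close>

lemma generator_graph_iff:
  "generator_graph m U u w \<longleftrightarrow> u \<in> D \<and> w \<in> L2 m \<and> (\<forall>v\<in>D. \<E> u v = - L2_inner m w v)"
proof
  assume "generator_graph m U u w"
  then obtain \<alpha> f where u: "u \<in> L2 m" and w: "w \<in> L2 m" and a: "\<alpha> > 0" and f: "f \<in> L2 m"
    and ue: "AE x in m. u x = kernel_op U \<alpha> f x"
    and we: "AE x in m. w x = \<alpha> * kernel_op U \<alpha> f x - f x"
    by (auto simp: generator_graph_def)
  let ?k = "kernel_op U \<alpha> f"
  have k: "?k \<in> D"
    using a f by (rule kernel_op_D)
  have uD: "u \<in> D"
    using ue by (intro D_cong[OF k L2_measurable[OF u]]) (auto elim: eventually_mono)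
  have "\<E> u v = - L2_inner m w v" if v: "v \<in> D" for v
  proof -
    have "L2_inner m w v = L2_inner m (\<lambda>x. \<alpha> * ?k x - f x) v"
      by (intro L2_inner_cong_AE we w f L2_diff L2_scale D_L2 k v)
    also have "\<dots> = - \<E> ?k v"
      using a f k v by (simp add: L2_inner_simps D_L2 kernel_op_energy)
    also have "\<E> ?k v = \<E> u v"
      using form_cong[OF uD k v ue] by simp
    finally show ?thesis
      by simp
  qed
  then show "u \<in> D \<and> w \<in> L2 m \<and> (\<forall>v\<in>D. \<E> u v = - L2_inner m w v)"
    using uD w by blast
next
  assume *: "u \<in> D \<and> w \<in> L2 m \<and> (\<forall>v\<in>D. \<E> u v = - L2_inner m w v)"
  \<comment> \<open>The datum whose resolvent image is \<open>u\<close> must be \<alpha> u - w; here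
    \<alpha> = 1.\<close>
  let ?f = "\<lambda>x. u x - w x"
  have f: "?f \<in> L2 m"
    using * D_L2 L2_diff by blast
  have ue: "AE x in m. u x = kernel_op U 1 ?f x"
    using * f by (intro kernel_op_unique) (auto simp: L2_inner_simps D_L2)
  have "AE x in m. w x = 1 * kernel_op U 1 ?f x - ?f x"
    using ue by eventually_elim simp
  then show "generator_graph m U u w"
    unfolding generator_graph_def using * D_L2 f ue by (metis zero_less_one)
qed

text \<open>Two values on the graph have equal pairings with all of \<open>D\<close>, so by density
  the choice made by \<open>SOME\<close> matters only on a null set.\<close>

lemma generator_AE:
  assumes "generator_graph m U u w"
  shows "AE x in m. generator m U u x = w x"
proof -
  let ?g = "generator m U u"
  have g: "generator_graph m U u ?g"
    unfolding generator_def by (rule someI[of "generator_graph m U u"], rule assms)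
  have "AE x in m. ?g x - w x = 0"
    using assms g unfolding generator_graph_iff
    by (intro orthogonal_to_D) (auto simp: L2_diff L2_inner_diff_left D_L2 eq_neg_iff_add_eq_0)
  then show ?thesis
    by auto
qed

lemma energy_null_generator_graph:
  assumes "u \<in> D" "\<E> u u = 0"
  shows "generator_graph m U u (\<lambda>_. 0)"
  using assms by (simp add: generator_graph_iff energy_null_form(1)[OF assms] D_L2[OF D_zero] L2_inner_eq_0_AE)

section \<open>Recurrence\<close>

text \<open>Recurrence only says that the potential of 1 is 0 or infinite; this excludes 0. On the
  zero set \<open>N\<close>, \<open>U\<^sub>1 1\<^sub>N\<close> vanishes as well, so its shifted
  energy \<open>(1\<^sub>N, U\<^sub>1 1\<^sub>N)\<close> is 0. Then \<open>1\<^sub>N\<close> is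
  orthogonal to \<open>D\<close>.\<close>

lemma kernel_one_pos: "AE x in m. 0 < kernel_op U 1 (\<lambda>_. 1) x"
proof -
  let ?k = "kernel_op U 1 (\<lambda>_. 1)"
  define N where "N = {x \<in> space m. ?k x = 0}"
  have "?k \<in> borel_measurable m"
    by (intro L2_measurable kernel_op_L2 const_L2) simp
  then have N: "N \<in> sets m"
    unfolding N_def by measurable
  let ?f = "indicator N :: 'a \<Rightarrow> real"
  have f: "?f \<in> L2 m"
    using N by (rule indicator_L2)
  have le: "kernel_op U 1 ?f x \<le> ?k x" if x: "x \<in> space m" for x
    unfolding kernel_op_def using N x
    by (intro integral_mono kernel_integrable[where B = 1]) (auto simp: indicator_def)
  have z: "?f x * kernel_op U 1 ?f x = 0" if x: "x \<in> space m" for x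
    using le[OF x] kernel_op_nonneg[of 1 x ?f] x by (auto simp: N_def indicator_def)
  have "L2_inner m ?f (kernel_op U 1 ?f) = (\<integral>x. 0 \<partial>m)"
    unfolding L2_inner_def by (rule Bochner_Integration.integral_cong) (use z in auto)
  then have k0: "AE x in m. kernel_op U 1 ?f x = 0"
    using f by (intro form_shift_self_eq_0[of 1]) (simp_all add: kernel_op_form kernel_op_D)
  have "L2_inner m ?f v = 0" if v: "v \<in> D" for v
  proof -
    have "\<E> (kernel_op U 1 ?f) v = 0"
      using form_cong[OF kernel_op_D[OF _ f] D_zero v, of 1] k0 form_zero_left[OF v] by simp
    then show ?thesis
      using kernel_op_energy[OF _ f v, of 1] L2_inner_eq_0_AE[OF k0] by simp
  qed
  then have "AE x in m. ?f x = 0"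
    by (rule orthogonal_to_D[OF f])
  with AE_space show ?thesis
  proof eventually_elim
    case (elim x)
    then have "?k x \<noteq> 0"
      by (auto simp: N_def indicator_def)
    then show ?case
      using kernel_op_nonneg[of 1 x "\<lambda>_. 1"] elim(1) by simp
  qed
qed

text \<open>For fixed \<open>k\<close> the truncations reach 1 as \<open>n\<close> grows, at a speed
  that is not controlled. The energy bound must therefore be uniform in \<open>n\<close>, so that a
  diagonal sequence can be chosen.\<close>

lemma recurrent_imp_conservative:
  assumes rec: "recurrent m U"
  shows "(\<lambda>_. 1) \<in> D \<and> \<E> (\<lambda>_. 1) (\<lambda>_. 1) = 0"
proof -
  define K where "K n = kernel_op U (1 / real (Suc n)) (\<lambda>_. 1)" for n
  have KD: "K n \<in> D" for n
    unfolding K_def by (intro kernel_op_D const_L2) simp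
  have nnK: "(\<integral>\<^sup>+y. ennreal 1 \<partial>U (1 / real (Suc n)) x) = ennreal (K n x)"
    if "x \<in> space m" for n x
    unfolding K_def using that by (intro nn_kernel_eq[where B = 1]) auto
  have K0: "0 \<le> K n x" if "x \<in> space m" for n x
    unfolding K_def using that by (intro kernel_op_nonneg) auto
  have Kmono: "K i x \<le> K j x" if "x \<in> space m" "i \<le> j" for i j x
    using incseqD[OF nn_kernel_incseq[OF that(1), of "\<lambda>_. ennreal 1"] that(2)]
      K0[OF that(1)] by (simp only: nnK[OF that(1)] ennreal_le_iff)
  have "{x \<in> space m. 0 < potential U (\<lambda>y. ennreal 1) x \<and> potential U (\<lambda>y. ennreal 1) x < \<infinity>}
      \<in> null_sets m"
    using rec unfolding recurrent_def by (elim allE[of _ "\<lambda>_. 1"]) simp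
  then have "AE x in m. \<not> (0 < potential U (\<lambda>y. ennreal 1) x \<and> potential U (\<lambda>y. ennreal 1) x < \<infinity>)"
    by (rule AE_I') (auto simp: zero_less_iff_neq_zero)
  with AE_space kernel_one_pos have inf: "AE x in m. (SUP n. ennreal (K n x)) = \<infinity>"
  proof eventually_elim
    case (elim x)
    have pot: "potential U (\<lambda>y. ennreal 1) x = (SUP n. ennreal (K n x))"
      using elim(1) by (simp only: potential_eq_SUP nnK)
    have "0 < ennreal (K 0 x)"
      using elim(2) by (simp add: K_def)
    also have "\<dots> \<le> (SUP n. ennreal (K n x))"
      by (rule SUP_upper) simp
    finally show ?case
      using elim(3) unfolding pot infinity_ennreal_def by (metis less_top)
  qed
  define c where "c k n = unit_contraction (\<lambda>x. 1 / real (Suc k) * K n x)" for k n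
  have cD: "c k n \<in> D" for k n
    unfolding c_def using KD by (intro contraction_mem D_scale)
  have c01: "0 \<le> c k n x" "c k n x \<le> 1" for k n x
    by (auto simp: c_def unit_contraction_def)
  have energy: "\<E> (c k n) (c k n) \<le> measure m (space m) / real (Suc k)" for k n
  proof -
    let ?a = "1 / real (Suc n)"
    \<comment> \<open>Pairing the resolvent image with the truncation leaves (1, c) minus a
      nonnegative term, so the bound depends on \<open>k\<close> alone.\<close>
    have "\<E> (c k n) (c k n) \<le> \<E> (\<lambda>x. 1 / real (Suc k) * K n x) (c k n)"
      unfolding c_def by (intro form_contraction_le D_scale KD)
    also have "\<dots> = (L2_inner m (\<lambda>_. 1) (c k n) - ?a * L2_inner m (K n) (c k n)) / real (Suc k)"
      using form_scale_left[OF KD[of n] cD[of k n], of "1 / real (Suc k)"]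
        kernel_op_energy[OF _ const_L2 cD[of k n], of ?a 1]
      by (simp add: K_def)
    also have "\<dots> \<le> measure m (space m) / real (Suc k)"
    proof (rule divide_right_mono)
      have "L2_inner m (\<lambda>_. 1) (c k n) \<le> (\<integral>x. 1 \<partial>m)"
        unfolding L2_inner_def using L2_integrable[OF D_L2[OF cD[of k n]]] c01
        by (intro integral_mono) auto
      moreover have "0 \<le> L2_inner m (K n) (c k n)"
        unfolding L2_inner_def using K0 c01 by (intro Bochner_Integration.integral_nonneg) auto
      then have "0 \<le> ?a * L2_inner m (K n) (c k n)"
        by simp
      ultimately show "L2_inner m (\<lambda>_. 1) (c k n) - ?a * L2_inner m (K n) (c k n)
          \<le> measure m (space m)"
        by simp
    qed simp
    finally show ?thesis .
  qed
  have conv: "(\<lambda>n. L2_inner m (\<lambda>x. c k n x - 1) (\<lambda>x. c k n x - 1)) \<longlonglongrightarrow> 0" for k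
  proof -
    have "(\<lambda>n. \<integral>x. (c k n x - 1) * (c k n x - 1) \<partial>m) \<longlonglongrightarrow> (\<integral>x. 0 \<partial>m)"
    proof (rule integral_dominated_convergence[where w = "\<lambda>_. 1"])
      show "AE x in m. (\<lambda>n. (c k n x - 1) * (c k n x - 1)) \<longlonglongrightarrow> 0"
        using AE_space inf
      proof eventually_elim
        case (elim x)
        have "ennreal (real (Suc k)) < (SUP n. ennreal (K n x))"
          unfolding elim(2) by (simp only: infinity_ennreal_def ennreal_less_top)
        then obtain n0 where n0: "ennreal (real (Suc k)) < ennreal (K n0 x)"
          by (auto simp only: less_SUP_iff)
        have "c k n x = 1" if "n0 \<le> n" for n
        proof -
          have "real (Suc k) \<le> K n0 x"
            using n0 K0[OF elim(1), of n0] by (simp add: ennreal_less_iff del: of_nat_Suc)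
          also have "\<dots> \<le> K n x"
            using Kmono[OF elim(1) that] .
          finally show ?thesis
            by (simp add: c_def unit_contraction_def)
        qed
        then show ?case
          by (intro tendsto_eventually eventually_sequentiallyI[of n0]) simp
      qed
      show "AE x in m. norm ((c k n x - 1) * (c k n x - 1)) \<le> 1" for n
      proof (rule AE_I2)
        fix x
        have "\<bar>c k n x - 1\<bar> \<le> 1"
          using c01[of k n x] by simp
        then show "norm ((c k n x - 1) * (c k n x - 1)) \<le> 1"
          using mult_mono[of "\<bar>c k n x - 1\<bar>" 1 "\<bar>c k n x - 1\<bar>" 1] by (simp add: abs_mult)
      qed
      show "(\<lambda>x. (c k n x - 1) * (c k n x - 1)) \<in> borel_measurable m" for n
        using L2_measurable[OF D_L2[OF cD[of k n]]] by simp
    qed auto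
    then show ?thesis
      by (simp add: L2_inner_def)
  qed
  \<comment> \<open>Diagonal choice: along \<open>n k\<close> both the energy and the distance to 1
    tend to 0.\<close>
  have "\<exists>n. L2_inner m (\<lambda>x. c k n x - 1) (\<lambda>x. c k n x - 1) < 1 / real (Suc k)" for k
    using eventually_happens[OF order_tendstoD(2)[OF conv[of k], of "1 / real (Suc k)"]] by auto
  then obtain n where n: "\<And>k. L2_inner m (\<lambda>x. c k (n k) x - 1) (\<lambda>x. c k (n k) x - 1) < 1 / real (Suc k)"
    by metis
  have lim0: "(\<lambda>k. C / real (Suc k)) \<longlonglongrightarrow> 0" for C :: real
    using LIMSEQ_Suc[OF lim_const_over_n[of C]] by simp
  show ?thesis
  proof (rule energy_null_limit[where v = "\<lambda>k. c k (n k)"])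
    show "(\<lambda>k. \<E> (c k (n k)) (c k (n k))) \<longlonglongrightarrow> 0"
      by (rule tendsto_sandwich[OF _ _ tendsto_const lim0[of "measure m (space m)"]])
        (auto intro!: always_eventually nonneg cD energy simp del: of_nat_Suc)
    show "(\<lambda>k. L2_inner m (\<lambda>x. c k (n k) x - 1) (\<lambda>x. c k (n k) x - 1)) \<longlonglongrightarrow> 0"
      by (rule tendsto_sandwich[OF _ _ tendsto_const lim0[of 1]])
        (auto intro!: always_eventually L2_inner_self_nonneg less_imp_le[OF n] simp del: of_nat_Suc)
  qed (auto intro: cD const_L2)
qed

end

section \<open>Consequences of the constant 1 having energy 0\<close>

locale conservative_form = form_resolvent +
  assumes one_D: "(\<lambda>_. 1) \<in> D" and form_one: "\<E> (\<lambda>_. 1) (\<lambda>_. 1) = 0"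
begin

lemma const_D: "(\<lambda>_. c) \<in> D"
  using D_scale[OF one_D, of c] by simp

lemma form_const: "\<E> (\<lambda>_. c) (\<lambda>_. c) = 0"
  using form_scale_left[OF one_D const_D[of c], of c] form_scale_right[OF one_D one_D, of c] form_one
  by simp

text \<open>Take 1 as the test function: the sector condition makes \<open>\<E>\<close> vanish with
  1 in its second argument, although the energy of 1 is all that is known.\<close>

lemma integral_kernel_op:
  assumes "\<alpha> > 0" "f \<in> L2 m"
  shows "\<alpha> * (\<integral>x. kernel_op U \<alpha> f x \<partial>m) = (\<integral>x. f x \<partial>m)"
  using kernel_op_energy[OF assms one_D]
    energy_null_form(2)[OF one_D form_one kernel_op_D[OF assms]]
  by (simp add: L2_inner_def)

text \<open>The defect is nonnegative and, by preservation of mass, has integral 0.\<close>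

lemma kernel_op_eqI:
  assumes "\<alpha> > 0" "f \<in> L2 m" "AE x in m. \<alpha> * kernel_op U \<alpha> f x \<le> f x"
  shows "AE x in m. \<alpha> * kernel_op U \<alpha> f x = f x"
proof -
  have int: "integrable m f" "integrable m (\<lambda>x. \<alpha> * kernel_op U \<alpha> f x)"
    using assms L2_integrable L2_scale kernel_op_L2 by blast+
  have "(\<integral>x. f x - \<alpha> * kernel_op U \<alpha> f x \<partial>m) = 0"
    using int integral_kernel_op[OF assms(1,2)] by simp
  then have "AE x in m. f x - \<alpha> * kernel_op U \<alpha> f x = 0"
    using int assms(3) by (subst (asm) integral_nonneg_eq_0_iff_AE) auto
  then show ?thesis
    by eventually_elim simp
qed

text \<open>
  The potential \<open>u\<close> of a bounded function \<open>f\<close> satisfies \<open>u = U\<^sub>\<beta> f + \<beta> U\<^sub>\<beta> u\<close>, so its truncations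
  are excessive and hence invariant, because \<open>\<beta> U\<^sub>\<beta>\<close> preserves the total mass.  On the set where
  \<open>u\<close> is finite this leaves \<open>U\<^sub>\<beta> f = 0\<close>.
\<close>

lemma kernel_op_eq_0_if_potential_finite:
  assumes f: "f \<in> borel_measurable m" "\<And>x. x \<in> space m \<Longrightarrow> 0 \<le> f x" "\<And>x. x \<in> space m \<Longrightarrow> f x \<le> 1"
    and b: "\<beta> > 0"
  shows "AE x in m. potential U (\<lambda>y. ennreal (f y)) x < \<infinity> \<longrightarrow> kernel_op U \<beta> f x = 0"
proof -
  define \<alpha> where "\<alpha> n = 1 / real (Suc n)" for n
  define K where "K n = kernel_op U (\<alpha> n) f" for n
  define u where "u = potential U (\<lambda>y. ennreal (f y))"
  have a: "\<alpha> n > 0" for n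
    by (simp add: \<alpha>_def)
  have fL: "f \<in> L2 m"
    using f by (intro bounded_L2[where B = 1]) auto
  have KL: "K n \<in> L2 m" for n
    unfolding K_def using a fL by (rule kernel_op_L2)
  have nnK: "(\<integral>\<^sup>+y. ennreal (f y) \<partial>U (\<alpha> n) x) = ennreal (K n x)" if "x \<in> space m" for n x
    unfolding K_def using f that a by (intro nn_kernel_eq[where B = 1]) auto
  have K0: "0 \<le> K n x" and Kle: "K n x \<le> 1 / \<alpha> n" if "x \<in> space m" for n x
    unfolding K_def using that f a by (auto intro: kernel_op_nonneg kernel_op_le)
  have Kinc: "incseq (\<lambda>n. ennreal (K n x))" if "x \<in> space m" for x
    using nn_kernel_incseq[OF that, of "\<lambda>y. ennreal (f y)"] nnK[OF that] by (simp add: \<alpha>_def)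
  have uSUP: "u x = (SUP n. ennreal (K n x))" if "x \<in> space m" for x
    using nnK[OF that] by (simp add: u_def potential_eq_SUP[OF that] \<alpha>_def)
  have u_meas: "u \<in> borel_measurable m"
    unfolding u_def using f(1) by (intro potential_measurable) simp
  have u_lim: "(\<lambda>n. ennreal (K n x)) \<longlonglongrightarrow> u x" if "x \<in> space m" for x
    unfolding uSUP[OF that] using Kinc[OF that] by (rule LIMSEQ_SUP)
  have int_lim: "(\<lambda>n. \<integral>\<^sup>+y. ennreal (K n y) \<partial>U \<beta> x) \<longlonglongrightarrow> (\<integral>\<^sup>+y. u y \<partial>U \<beta> x)"
    if x: "x \<in> space m" for x
  proof -
    note sp = kernel_space[OF b x]
    have mono: "ennreal (K n y) \<le> ennreal (K (Suc n) y)" if "y \<in> space m" for n y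
      using incseq_SucD[OF Kinc[OF that]] .
    have "(\<integral>\<^sup>+y. u y \<partial>U \<beta> x) = (\<integral>\<^sup>+y. (SUP n. ennreal (K n y)) \<partial>U \<beta> x)"
      using uSUP sp by (intro nn_integral_cong) auto
    also have "\<dots> = (SUP n. \<integral>\<^sup>+y. ennreal (K n y) \<partial>U \<beta> x)"
      using mono sp L2_measurable[OF KL]
      by (intro nn_integral_monotone_convergence_SUP_AE AE_I2 kernel_measurable[OF b x]) auto
    finally show ?thesis
      using mono sp
      by (auto intro!: LIMSEQ_SUP incseq_SucI nn_integral_mono)
  qed
  \<comment> \<open>One null set serves all \<open>n\<close>. Away from it \<open>f\<close> and
    \<open>K n\<close> are bounded, so the right side can be split pointwise.\<close>
  have "AE x in m. \<forall>n. K n x = kernel_op U \<beta> (\<lambda>y. f y + (\<beta> - \<alpha> n) * K n y) x"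
    unfolding AE_all_countable K_def using resolvent_L2[OF a b fL] by blast
  then have u_eq: "AE x in m. u x = ennreal (kernel_op U \<beta> f x) + ennreal \<beta> * (\<integral>\<^sup>+y. u y \<partial>U \<beta> x)"
    using AE_space
  proof eventually_elim
    case (elim x)
    note x = elim(2)
    have "\<alpha> \<longlonglongrightarrow> 0"
      unfolding \<alpha>_def using LIMSEQ_Suc[OF lim_const_over_n[of "1 :: real"]] by simp
    then have ev: "\<forall>\<^sub>F n in sequentially. \<alpha> n < \<beta>"
      using b by (rule order_tendstoD(2))
    \<comment> \<open>\<open>ennreal\<close> sends negative numbers to 0, so the identity passes to
      extended values only once \<open>\<alpha> n < \<beta>\<close>, which holds eventually.\<close>
    have eq: "ennreal (K n x) = ennreal (kernel_op U \<beta> f x)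
        + ennreal (\<beta> - \<alpha> n) * (\<integral>\<^sup>+y. ennreal (K n y) \<partial>U \<beta> x)" if n: "\<alpha> n < \<beta>" for n
    proof -
      have "integrable (U \<beta> x) f"
        using f by (intro kernel_integrable[OF b x, where B = 1]) auto
      moreover have "integrable (U \<beta> x) (K n)"
        using L2_measurable[OF KL[of n]] K0 Kle
        by (intro kernel_integrable[OF b x, where B = "1 / \<alpha> n"]) auto
      ultimately have int: "integrable (U \<beta> x) f" "integrable (U \<beta> x) (K n)" .
      have "K n x = kernel_op U \<beta> (\<lambda>y. f y + (\<beta> - \<alpha> n) * K n y) x"
        using elim(1) by blast
      also have "\<dots> = kernel_op U \<beta> f x + (\<beta> - \<alpha> n) * kernel_op U \<beta> (K n) x"
        using int by (simp add: kernel_op_def)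
      finally have "ennreal (K n x)
          = ennreal (kernel_op U \<beta> f x) + ennreal (\<beta> - \<alpha> n) * ennreal (kernel_op U \<beta> (K n) x)"
        using n b x f K0 by (simp add: kernel_op_nonneg ennreal_mult')
      also have "ennreal (kernel_op U \<beta> (K n) x) = (\<integral>\<^sup>+y. ennreal (K n y) \<partial>U \<beta> x)"
        using b x KL[of n, THEN L2_measurable] K0 Kle
        by (intro nn_kernel_eq[symmetric, where B = "1 / \<alpha> n"]) auto
      finally show ?thesis .
    qed
    have "(\<lambda>n. ennreal (\<beta> - \<alpha> n)) \<longlonglongrightarrow> ennreal (\<beta> - 0)"
      using \<open>\<alpha> \<longlonglongrightarrow> 0\<close> by (intro tendsto_intros)
    then have "(\<lambda>n. ennreal (kernel_op U \<beta> f x)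
        + ennreal (\<beta> - \<alpha> n) * (\<integral>\<^sup>+y. ennreal (K n y) \<partial>U \<beta> x))
      \<longlonglongrightarrow> ennreal (kernel_op U \<beta> f x) + ennreal \<beta> * (\<integral>\<^sup>+y. u y \<partial>U \<beta> x)"
      using b int_lim[OF x] by (intro tendsto_add tendsto_const tendsto_mult_ennreal) auto
    then have "(\<lambda>n. ennreal (K n x))
      \<longlonglongrightarrow> ennreal (kernel_op U \<beta> f x) + ennreal \<beta> * (\<integral>\<^sup>+y. u y \<partial>U \<beta> x)"
      using ev eq by (elim Lim_transform_eventually) (auto elim!: eventually_mono)
    then show ?case
      using u_lim[OF x] LIMSEQ_unique by blast
  qed
  have trunc: "AE x in m. ennreal \<beta> * (\<integral>\<^sup>+y. min (u y) (of_nat k) \<partial>U \<beta> x) = min (u x) (of_nat k)"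
    for k :: nat
  proof -
    \<comment> \<open>The truncation is at most \<open>k\<close>, so the conversion to reals loses
      nothing, even where \<open>u\<close> is infinite, and \<open>h\<close> is square
      integrable.\<close>
    define h where "h x = enn2real (min (u x) (of_nat k))" for x
    have nn_h: "ennreal (h x) = min (u x) (of_nat k)" for x
      unfolding h_def by (intro ennreal_enn2real) (auto simp: min_less_iff_disj of_nat_less_top)
    have h01: "0 \<le> h x" "h x \<le> real k" for x
    proof -
      show "0 \<le> h x"
        by (simp add: h_def)
      have "ennreal (h x) \<le> ennreal (real k)"
        unfolding nn_h by (simp flip: ennreal_of_nat_eq_real_of_nat)
      then show "h x \<le> real k"
        by simp
    qed
    have h_meas: "h \<in> borel_measurable m"
      unfolding h_def using u_meas by measurable
    then have hL: "h \<in> L2 m"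
      using h01 by (intro bounded_L2[where B = k]) auto
    have nn_kh: "(\<integral>\<^sup>+y. min (u y) (of_nat k) \<partial>U \<beta> x) = ennreal (kernel_op U \<beta> h x)"
      if "x \<in> space m" for x
      unfolding nn_h[symmetric] using b that h_meas h01 by (intro nn_kernel_eq) auto
    have "AE x in m. \<beta> * kernel_op U \<beta> h x \<le> h x"
      using u_eq AE_space
    proof eventually_elim
      case (elim x)
      have "ennreal (\<beta> * kernel_op U \<beta> h x) = ennreal \<beta> * (\<integral>\<^sup>+y. min (u y) (of_nat k) \<partial>U \<beta> x)"
        using b by (simp add: nn_kh[OF elim(2)] ennreal_mult')
      also have "\<dots> \<le> ennreal \<beta> * (\<integral>\<^sup>+y. u y \<partial>U \<beta> x)"
        by (intro mult_left_mono nn_integral_mono) auto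
      also have "\<dots> \<le> u x"
        by (subst elim(1)) simp
      finally have 1: "ennreal (\<beta> * kernel_op U \<beta> h x) \<le> u x" .
      have "\<beta> * kernel_op U \<beta> h x \<le> real k"
        using kernel_op_le[OF b elim(2) h_meas, of k] h01 b by (simp add: field_simps)
      then have "ennreal (\<beta> * kernel_op U \<beta> h x) \<le> of_nat k"
        by (simp add: ennreal_of_nat_eq_real_of_nat ennreal_leI)
      with 1 have "ennreal (\<beta> * kernel_op U \<beta> h x) \<le> ennreal (h x)"
        by (simp add: nn_h)
      then show ?case
        using h01 by simp
    qed
    from kernel_op_eqI[OF b hL this] AE_space show ?thesis
    proof eventually_elim
      case (elim x)
      have "ennreal \<beta> * (\<integral>\<^sup>+y. min (u y) (of_nat k) \<partial>U \<beta> x) = ennreal (\<beta> * kernel_op U \<beta> h x)"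
        using b by (simp add: nn_kh[OF elim(2)] ennreal_mult')
      then show ?case
        by (simp add: elim(1) nn_h)
    qed
  qed
  then have "AE x in m. \<forall>k::nat. ennreal \<beta> * (\<integral>\<^sup>+y. min (u y) (of_nat k) \<partial>U \<beta> x) = min (u x) (of_nat k)"
    by (simp add: AE_all_countable)
  with u_eq AE_space have "AE x in m. u x < \<infinity> \<longrightarrow> kernel_op U \<beta> f x = 0"
  proof eventually_elim
    case (elim x)
    show ?case
    proof
      \<comment> \<open>For \<open>k\<close> above \<open>u x\<close> the truncated identity gives
        \<open>u x \<le> \<beta> U\<^sub>\<beta> u x\<close>, whereas \<open>u_eq\<close> has the
        further summand \<open>U\<^sub>\<beta> f x\<close>. Finiteness of \<open>u x\<close> permits
        the cancellation.\<close>
      assume fin: "u x < \<infinity>"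
      then obtain k :: nat where "u x < of_nat k"
        using ennreal_Ex_less_of_nat by auto
      then have "u x = ennreal \<beta> * (\<integral>\<^sup>+y. min (u y) (of_nat k) \<partial>U \<beta> x)"
        using elim(3) by (simp add: min_absorb1 less_imp_le)
      also have "\<dots> \<le> ennreal \<beta> * (\<integral>\<^sup>+y. u y \<partial>U \<beta> x)"
        by (intro mult_left_mono nn_integral_mono) auto
      finally have "ennreal (kernel_op U \<beta> f x) + u x \<le> 0 + u x"
        using add_left_mono elim(1) by (metis add_0)
      then have "ennreal (kernel_op U \<beta> f x) \<le> 0"
        using fin by (auto simp: ennreal_add_left_cancel_le add.commute[of _ "u x"])
      then show "kernel_op U \<beta> f x = 0"
        using kernel_op_nonneg[OF b elim(2), of f] f by simp
    qed
  qed
  then show ?thesis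
    by (simp add: u_def)
qed

text \<open>An integrable \<open>f\<close> may be unbounded, so \<open>g = min f 1\<close> is used:
  it has the same zeros and a smaller potential. Where the potential of \<open>f\<close> is finite,
  the kernels give \<open>g\<close> integral 0, hence do not charge the set where \<open>f\<close>
  is positive, and the potential of \<open>f\<close> is 0.\<close>

lemma conservative_recurrent: "recurrent m U"
  unfolding recurrent_def
proof (intro allI impI, elim conjE)
  fix f :: "'a \<Rightarrow> real" assume int: "integrable m f" and f0: "\<forall>x\<in>space m. 0 \<le> f x"
  have f_meas: "f \<in> borel_measurable m"
    using int by simp
  define g where "g x = min (f x) 1" for x
  have g: "g \<in> borel_measurable m" "\<And>x. x \<in> space m \<Longrightarrow> 0 \<le> g x" "\<And>x. x \<in> space m \<Longrightarrow> g x \<le> 1"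
    using f_meas f0 unfolding g_def by auto
  let ?pf = "potential U (\<lambda>y. ennreal (f y))"
  let ?pg = "potential U (\<lambda>y. ennreal (g y))"
  have "AE x in m. \<forall>n. ?pg x < \<infinity> \<longrightarrow> kernel_op U (1 / real (Suc n)) g x = 0"
    unfolding AE_all_countable by (intro allI kernel_op_eq_0_if_potential_finite g) simp_all
  with AE_space have "AE x in m. \<not> (0 < ?pf x \<and> ?pf x < \<infinity>)"
  proof eventually_elim
    case (elim x)
    note x = elim(1)
    have nn: "(\<integral>\<^sup>+y. ennreal (g y) \<partial>U (1 / real (Suc n)) x)
        = ennreal (kernel_op U (1 / real (Suc n)) g x)" for n
      using x g by (intro nn_kernel_eq[where B = 1]) auto
    show ?case
    proof
      assume fin: "0 < ?pf x \<and> ?pf x < \<infinity>"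
      have "?pg x \<le> ?pf x"
        unfolding potential_eq_SUP[OF x] g_def
        by (intro SUP_mono' nn_integral_mono ennreal_leI) simp
      then have "?pg x < \<infinity>"
        using fin by (auto intro: le_less_trans)
      then have g_zero: "(\<integral>\<^sup>+y. ennreal (g y) \<partial>U (1 / real (Suc n)) x) = 0" for n
        using elim(2) by (simp add: nn del: of_nat_Suc)
      have "(\<integral>\<^sup>+y. ennreal (f y) \<partial>U (1 / real (Suc n)) x) = 0" for n
      proof -
        have pos: "0 < 1 / real (Suc n)"
          by simp
        have meas: "(\<lambda>y. ennreal (f y)) \<in> borel_measurable (U (1 / real (Suc n)) x)"
          "(\<lambda>y. ennreal (g y)) \<in> borel_measurable (U (1 / real (Suc n)) x)"
          by (rule kernel_measurable[OF pos x], use f_meas g(1) in measurable)+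
        have "AE y in U (1 / real (Suc n)) x. ennreal (g y) = 0"
          using g_zero[of n] by (simp only: nn_integral_0_iff_AE[OF meas(2)])
        then have "AE y in U (1 / real (Suc n)) x. ennreal (f y) = 0"
          by eventually_elim (auto simp: g_def ennreal_eq_0_iff min_def split: if_splits)
        then show ?thesis
          by (simp only: nn_integral_0_iff_AE[OF meas(1)])
      qed
      then show False
        using fin by (simp add: potential_eq_SUP[OF x])
    qed
  qed
  moreover have "{x \<in> space m. 0 < ?pf x \<and> ?pf x < \<infinity>} \<in> sets m"
    using potential_measurable[of "\<lambda>y. ennreal (f y)"] f_meas by measurable
  ultimately show "{x \<in> space m. 0 < ?pf x \<and> ?pf x < \<infinity>} \<in> null_sets m"
    by (subst AE_iff_null_sets) auto
qed

end

context conservative_form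
begin

section \<open>Irreducibility\<close>

text \<open>The image of the indicator under \<open>U\<^sub>1\<close> is 0 on \<open>A\<close> by
  assumption and at most 1 elsewhere, so the indicator dominates it. Preservation of mass turns this
  one-sided invariance into a fixed point.\<close>

lemma invariant_energy_null:
  assumes A: "A \<in> sets m"
    and inv: "AE x in m. x \<in> A \<longrightarrow> potential U (indicator (space m - A)) x = 0"
  shows "(indicator (space m - A) :: 'a \<Rightarrow> real) \<in> D"
    and "\<E> (indicator (space m - A)) (indicator (space m - A)) = 0"
proof -
  let ?B = "space m - A"
  let ?f = "indicator ?B :: 'a \<Rightarrow> real"
  have B: "?B \<in> sets m"
    using A by auto
  have f: "?f \<in> L2 m"
    using B by (rule indicator_L2)
  have "AE x in m. 1 * kernel_op U 1 ?f x \<le> ?f x"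
    using AE_space inv
  proof eventually_elim
    case (elim x)
    show ?case
    proof (cases "x \<in> A")
      case True
      then have "measure (U 1 x) ?B = 0"
        using potential_indicator_measure_0[of 1 x ?B] elim B by (simp add: measure_def)
      then show ?thesis
        using elim(1) B by (simp add: kernel_op_indicator)
    next
      case False
      then show ?thesis
        using kernel_op_le[of 1 x ?f 1] elim(1) B by (simp add: indicator_def)
    qed
  qed
  then have "AE x in m. 1 * kernel_op U 1 ?f x = ?f x"
    using f by (intro kernel_op_eqI) simp_all
  then show "?f \<in> D" "\<E> ?f ?f = 0"
    using fixed_energy_null[OF _ f, of 1] by auto
qed

text \<open>The indicator is fixed for every \<alpha> = 1/(n+1), so at almost every point off
  \<open>B\<close> none of these kernels charges \<open>B\<close>.\<close>

lemma energy_null_invariant: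
  assumes B: "B \<in> sets m" and D: "(indicator B :: 'a \<Rightarrow> real) \<in> D" "\<E> (indicator B) (indicator B) = 0"
  shows "AE x in m. x \<notin> B \<longrightarrow> potential U (indicator B) x = 0"
proof -
  have "AE x in m. \<forall>n. 1 / real (Suc n) * kernel_op U (1 / real (Suc n)) (indicator B) x
      = indicator B x"
    unfolding AE_all_countable by (intro allI energy_null_fixed[OF _ D]) simp
  with AE_space show ?thesis
  proof eventually_elim
    case (elim x)
    show ?case
      using elim kernel_op_indicator[OF _ elim(1) B]
      by (auto simp: potential_indicator_eq_0[OF elim(1) B] simp del: of_nat_Suc)
  qed
qed

text \<open>The unit contractions of \<open>n * (u - c)\<close> converge pointwise to the indicator;
  at points with \<open>u x = c\<close> they are all 0, which is why the inequality is
  strict.\<close>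

lemma superlevel_energy_null:
  assumes u: "u \<in> D" "\<E> u u = 0"
  shows "(indicator {x \<in> space m. u x > c} :: 'a \<Rightarrow> real) \<in> D \<and>
    \<E> (indicator {x \<in> space m. u x > c}) (indicator {x \<in> space m. u x > c}) = 0"
proof -
  let ?B = "{x \<in> space m. u x > c}"
  define w where "w n x = real n * (u x - c)" for n x
  define v where "v n = unit_contraction (w n)" for n
  have um: "u \<in> borel_measurable m"
    using u(1) D_L2 L2_measurable by blast
  have B: "?B \<in> sets m"
    using um by measurable
  have w: "w n \<in> D" "\<E> (w n) (w n) = 0" for n
  proof -
    have uc: "(\<lambda>x. u x - c) \<in> D" "\<E> (\<lambda>x. u x - c) (\<lambda>x. u x - c) = 0"
      using u const_D form_const by (auto intro: D_diff energy_null_diff)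
    then show "w n \<in> D" "\<E> (w n) (w n) = 0"
      unfolding w_def by (simp_all add: D_scale form_scale_left form_scale_right)
  qed
  have v: "v n \<in> D" for n
    unfolding v_def using w by (intro contraction_mem)
  \<comment> \<open>\<open>form_contraction_le\<close> bounds this by the pairing of
    \<open>w n\<close> with \<open>v n\<close>, which vanishes because \<open>w n\<close> has energy
    0.\<close>
  have E: "\<E> (v n) (v n) = 0" for n
    using form_contraction_le[OF w(1)[of n]] energy_null_form(1)[OF w v[of n]] nonneg[OF v[of n]]
    by (simp add: v_def)
  have v01: "0 \<le> v n x" "v n x \<le> 1" for n x
    by (auto simp: v_def unit_contraction_def)
  have "(\<lambda>n. \<integral>x. (v n x - indicator ?B x) * (v n x - indicator ?B x) \<partial>m) \<longlonglongrightarrow> (\<integral>x. 0 \<partial>m)"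
  proof (rule integral_dominated_convergence[where w = "\<lambda>_. 1"])
    show "AE x in m. (\<lambda>n. (v n x - indicator ?B x) * (v n x - indicator ?B x)) \<longlonglongrightarrow> 0"
      using AE_space
    proof eventually_elim
      case (elim x)
      show ?case
      proof (cases "u x > c")
        case True
        then obtain n0 where n0: "1 < real n0 * (u x - c)"
          using ex_less_of_nat_mult[of "u x - c" 1] by auto
        have "v n x = 1" if "n0 \<le> n" for n
        proof -
          have "real n0 * (u x - c) \<le> real n * (u x - c)"
            using True that by (intro mult_right_mono) auto
          then show ?thesis
            using n0 by (simp add: v_def w_def unit_contraction_def)
        qed
        then show ?thesis
          using True elim by (intro tendsto_eventually eventually_sequentiallyI[of n0]) simp
      next
        case False
        then have "v n x = 0" for n
          by (simp add: v_def w_def unit_contraction_def mult_nonneg_nonpos)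
        then show ?thesis
          using False by simp
      qed
    qed
    show "AE x in m. norm ((v n x - indicator ?B x) * (v n x - indicator ?B x)) \<le> 1" for n
    proof (rule AE_I2)
      fix x
      have "\<bar>v n x - indicator ?B x\<bar> \<le> 1"
        using v01[of n x] by (simp add: indicator_def)
      then show "norm ((v n x - indicator ?B x) * (v n x - indicator ?B x)) \<le> 1"
        using mult_mono[of "\<bar>v n x - indicator ?B x\<bar>" 1 "\<bar>v n x - indicator ?B x\<bar>" 1]
        by (simp add: abs_mult)
    qed
    show "(\<lambda>x. (v n x - indicator ?B x) * (v n x - indicator ?B x)) \<in> borel_measurable m" for n
      using L2_measurable[OF D_L2[OF v[of n]]] B by measurable
  qed auto
  then have "(\<lambda>n. L2_inner m (\<lambda>x. v n x - indicator ?B x) (\<lambda>x. v n x - indicator ?B x)) \<longlonglongrightarrow> 0"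
    by (simp add: L2_inner_def)
  then show ?thesis
    using v E indicator_L2[OF B] by (intro energy_null_limit[where v = v]) simp_all
qed

lemma irreducible_iff_energy:
  "irreducible_resolvent m U \<longleftrightarrow> (\<forall>u\<in>D. \<E> u u = 0 \<longrightarrow> ae_constant m u)"
proof
  assume irr: "irreducible_resolvent m U"
  show "\<forall>u\<in>D. \<E> u u = 0 \<longrightarrow> ae_constant m u"
  proof (intro ballI impI)
    fix u assume u: "u \<in> D" "\<E> u u = 0"
    have um: "u \<in> borel_measurable m"
      using u(1) D_L2 L2_measurable by blast
    show "ae_constant m u"
    proof (rule ae_constantI_thresholds[OF um])
      fix c
      let ?B = "{x \<in> space m. u x > c}"
      have B: "?B \<in> sets m" and AB: "space m - ?B \<in> sets m"
        using um by measurable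
      have BB: "space m - (space m - ?B) = ?B"
        by auto
      \<comment> \<open>Irreducibility is applied to the set where \<open>u \<le> c\<close>, whose
        complement is the superlevel set.\<close>
      have "AE x in m. x \<in> space m - ?B \<longrightarrow> potential U (indicator (space m - (space m - ?B))) x = 0"
        using energy_null_invariant[OF B] superlevel_energy_null[OF u, of c] unfolding BB
        by (auto elim!: eventually_mono)
      then have "emeasure m (space m - ?B) = 0 \<or> emeasure m (space m - (space m - ?B)) = 0"
        by (rule mp[OF bspec[OF irr[unfolded irreducible_resolvent_def] AB]])
      then have "emeasure m (space m - ?B) = 0 \<or> emeasure m ?B = 0"
        unfolding BB .
      then have "(AE x in m. x \<notin> space m - ?B) \<or> (AE x in m. x \<notin> ?B)"
      proof
        assume "emeasure m (space m - ?B) = 0"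
        then have "AE x in m. x \<notin> space m - ?B"
          using AB by (intro AE_not_in null_setsI)
        then show ?thesis ..
      next
        assume "emeasure m ?B = 0"
        then have "AE x in m. x \<notin> ?B"
          using B by (intro AE_not_in null_setsI)
        then show ?thesis ..
      qed
      then show "(AE x in m. u x > c) \<or> (AE x in m. u x \<le> c)"
      proof
        assume "AE x in m. x \<notin> space m - ?B"
        with AE_space have "AE x in m. u x > c"
          by eventually_elim auto
        then show ?thesis ..
      next
        assume "AE x in m. x \<notin> ?B"
        with AE_space have "AE x in m. u x \<le> c"
          by eventually_elim auto
        then show ?thesis ..
      qed
    qed
  qed
next
  assume const: "\<forall>u\<in>D. \<E> u u = 0 \<longrightarrow> ae_constant m u"
  show "irreducible_resolvent m U"
    unfolding irreducible_resolvent_def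
  proof (intro ballI impI)
    fix A assume A: "A \<in> sets m"
      and inv: "AE x in m. x \<in> A \<longrightarrow> potential U (indicator (space m - A)) x = 0"
    have "ae_constant m (indicator (space m - A) :: 'a \<Rightarrow> real)"
      using const invariant_energy_null[OF A inv] by blast
    then show "emeasure m A = 0 \<or> emeasure m (space m - A) = 0"
      using AE_indicator_const[of "space m - A" m] A sets.sets_into_space[OF A]
      by (auto simp: ae_constant_def double_diff)
  qed
qed

text \<open>Testing the weak form with \<open>u\<close> itself gives \<E>(u, u) = - (L u, u), so L u
  = 0 forces energy 0; conversely 0 is a generator value of every function of energy 0.\<close>

lemma irreducible_iff_generator:
  "irreducible_resolvent m U \<longleftrightarrow>
    (\<forall>u\<in>generator_dom m U. (AE x in m. generator m U u x = 0) \<longrightarrow> ae_constant m u)"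
  unfolding irreducible_iff_energy
proof (intro iffI ballI impI)
  fix u assume const: "\<forall>u\<in>D. \<E> u u = 0 \<longrightarrow> ae_constant m u"
    and "u \<in> generator_dom m U" and Lu: "AE x in m. generator m U u x = 0"
  then obtain w where w: "generator_graph m U u w"
    by (auto simp: generator_dom_def)
  have "AE x in m. w x = 0"
    using generator_AE[OF w] Lu by eventually_elim simp
  then have "\<E> u u = 0" "u \<in> D"
    using w L2_inner_eq_0_AE[of w m u] by (auto simp: generator_graph_iff)
  then show "ae_constant m u"
    using const by blast
next
  fix u assume "\<forall>u\<in>generator_dom m U. (AE x in m. generator m U u x = 0) \<longrightarrow> ae_constant m u"
    and "u \<in> D" "\<E> u u = 0"
  then show "ae_constant m u"
    using energy_null_generator_graph[of u] generator_AE[of u "\<lambda>_. 0"]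
    by (auto simp: generator_dom_def)
qed

text \<open>
  Multiplication by the indicator of an invariant set commutes with the resolvent because
  \<open>U\<^sub>\<alpha>(x, \<cdot>)\<close> does not charge the complement of the part containing \<open>x\<close>.
\<close>

lemma invariant_indicator_mult_generator:
  assumes B: "B \<in> sets m" and D: "(indicator B :: 'a \<Rightarrow> real) \<in> D" "\<E> (indicator B) (indicator B) = 0"
    and g: "generator_graph m U v w"
  shows "generator_graph m U (\<lambda>x. indicator B x * v x) (\<lambda>x. indicator B x * w x)"
proof -
  let ?C = "space m - B"
  have C: "?C \<in> sets m"
    using B by auto
  have invB: "AE x in m. x \<notin> B \<longrightarrow> potential U (indicator B) x = 0"
    by (rule energy_null_invariant[OF B D])
  have null: "(\<lambda>x. 1 - indicator B x :: real) \<in> D"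
    "\<E> (\<lambda>x. 1 - indicator B x) (\<lambda>x. 1 - indicator B x) = 0"
    using D const_D form_const by (auto intro: D_diff energy_null_diff)
  \<comment> \<open>The two functions differ outside \<open>space m\<close>, so membership and
    energy pass through equality almost everywhere.\<close>
  have ae: "AE x in m. 1 - indicator B x = (indicator ?C x :: real)"
    using AE_space by eventually_elim (auto simp: indicator_def)
  have CD: "(indicator ?C :: 'a \<Rightarrow> real) \<in> D"
    using C by (intro D_cong[OF null(1) _ ae]) simp
  have "\<E> (indicator ?C) (indicator ?C) = 0"
    using form_cong[OF null(1) CD null(1) ae] form_cong[OF null(1) CD CD ae] null(2) by simp
  then have invC: "AE x in m. x \<notin> ?C \<longrightarrow> potential U (indicator ?C) x = 0"
    by (rule energy_null_invariant[OF C CD])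
  have mult: "(\<lambda>x. indicator B x * h x) \<in> L2 m" if "h \<in> L2 m" for h
  proof -
    have "integrable m (\<lambda>x. indicator B x *\<^sub>R (h x)\<^sup>2)"
      using that B by (intro integrable_mult_indicator) (simp_all add: L2_def)
    also have "(\<lambda>x. indicator B x *\<^sub>R (h x)\<^sup>2) = (\<lambda>x. (indicator B x * h x)\<^sup>2)"
      by (intro ext) (simp add: indicator_def)
    finally show ?thesis
      using that B by (auto simp: L2_def intro!: borel_measurable_times borel_measurable_indicator)
  qed
  obtain \<alpha> f where v: "v \<in> L2 m" and w: "w \<in> L2 m" and a: "\<alpha> > 0" and f: "f \<in> L2 m"
    and ve: "AE x in m. v x = kernel_op U \<alpha> f x"
    and we: "AE x in m. w x = \<alpha> * kernel_op U \<alpha> f x - f x"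
    using g by (auto simp: generator_graph_def)
  have "AE x in m. indicator B x * kernel_op U \<alpha> f x = kernel_op U \<alpha> (\<lambda>y. indicator B y * f y) x"
    using AE_space invB invC
  proof eventually_elim
    case (elim x)
    have m: "f \<in> borel_measurable (U \<alpha> x)" "(\<lambda>y. indicator B y * f y) \<in> borel_measurable (U \<alpha> x)"
      using mult[OF f] f L2_measurable by (auto intro!: kernel_measurable[OF a elim(1)])
    note sp = kernel_space[OF a elim(1)] and se = sets_kernel[OF a elim(1)]
    show ?case
    \<comment> \<open>For \<open>x\<close> in \<open>B\<close> the kernel does not charge
      \<open>?C\<close>, so the factor \<open>indicator B\<close> changes nothing under the
      integral; otherwise both sides are 0. This also covers points where \<open>f\<close> is not
      integrable.\<close>
    proof (cases "x \<in> B")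
      case True
      then have "emeasure (U \<alpha> x) ?C = 0"
        using potential_indicator_measure_0[OF a elim(1) C] elim by simp
      then have "?C \<in> null_sets (U \<alpha> x)"
        using C se by auto
      then have "AE y in U \<alpha> x. y \<notin> ?C"
        by (rule AE_not_in)
      with AE_space have "AE y in U \<alpha> x. f y = indicator B y * f y"
        by eventually_elim (auto simp: sp)
      then have "(\<integral>y. f y \<partial>U \<alpha> x) = (\<integral>y. indicator B y * f y \<partial>U \<alpha> x)"
        by (rule integral_cong_AE[OF m])
      then show ?thesis
        using True by (simp add: kernel_op_def)
    next
      case False
      then have "emeasure (U \<alpha> x) B = 0"
        using potential_indicator_measure_0[OF a elim(1) B] elim by simp
      then have "B \<in> null_sets (U \<alpha> x)"
        using B se by auto
      then have "AE y in U \<alpha> x. y \<notin> B"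
        by (rule AE_not_in)
      then have "AE y in U \<alpha> x. indicator B y * f y = 0"
        by eventually_elim auto
      then show ?thesis
        using False by (simp add: kernel_op_def integral_eq_zero_AE)
    qed
  qed
  note comm = this
  show ?thesis
    unfolding generator_graph_def
  proof (intro conjI exI[of _ \<alpha>] a bexI[OF _ mult[OF f]] mult v w)
    show "AE x in m. indicator B x * v x = kernel_op U \<alpha> (\<lambda>x. indicator B x * f x) x"
      using ve comm by eventually_elim simp
    show "AE x in m. indicator B x * w x = \<alpha> * kernel_op U \<alpha> (\<lambda>x. indicator B x * f x) x - indicator B x * f x"
      using we comm by eventually_elim (metis mult.left_commute right_diff_distrib)
  qed
qed

text \<open>The test \<open>v = 1\<close> yields L u = u L 1 = 0, so a multiplier lies in the kernel
  of the generator. Conversely the indicator of an invariant set is a multiplier, hence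
  constant.\<close>

lemma irreducible_iff_multiplier:
  "irreducible_resolvent m U \<longleftrightarrow>
    (\<forall>u\<in>generator_dom m U.
      (\<forall>v\<in>generator_dom m U.
        (\<lambda>x. u x * v x) \<in> generator_dom m U \<and>
        (AE x in m. generator m U (\<lambda>x. u x * v x) x = u x * generator m U v x)) \<longrightarrow>
      ae_constant m u)"
proof
  assume irr: "irreducible_resolvent m U"
  show "\<forall>u\<in>generator_dom m U.
      (\<forall>v\<in>generator_dom m U.
        (\<lambda>x. u x * v x) \<in> generator_dom m U \<and>
        (AE x in m. generator m U (\<lambda>x. u x * v x) x = u x * generator m U v x)) \<longrightarrow>
      ae_constant m u"
  proof (intro ballI impI)
    fix u assume u: "u \<in> generator_dom m U"
      and mult: "\<forall>v\<in>generator_dom m U.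
        (\<lambda>x. u x * v x) \<in> generator_dom m U \<and>
        (AE x in m. generator m U (\<lambda>x. u x * v x) x = u x * generator m U v x)"
    note one = energy_null_generator_graph[OF one_D form_one]
    then have "AE x in m. generator m U (\<lambda>x. u x * 1) x = u x * generator m U (\<lambda>_. 1) x"
      using mult by (auto simp only: generator_dom_def)
    with generator_AE[OF one] have "AE x in m. generator m U u x = 0"
      by eventually_elim simp
    then show "ae_constant m u"
      using irr u irreducible_iff_generator by blast
  qed
next
  assume mult: "\<forall>u\<in>generator_dom m U.
      (\<forall>v\<in>generator_dom m U.
        (\<lambda>x. u x * v x) \<in> generator_dom m U \<and>
        (AE x in m. generator m U (\<lambda>x. u x * v x) x = u x * generator m U v x)) \<longrightarrow>
      ae_constant m u"
  show "irreducible_resolvent m U"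
    unfolding irreducible_resolvent_def
  proof (intro ballI impI)
    fix A assume A: "A \<in> sets m"
      and inv: "AE x in m. x \<in> A \<longrightarrow> potential U (indicator (space m - A)) x = 0"
    let ?B = "space m - A"
    let ?u = "indicator ?B :: 'a \<Rightarrow> real"
    have B: "?B \<in> sets m"
      using A by auto
    note null = invariant_energy_null[OF A inv]
    have "?u \<in> generator_dom m U"
      using energy_null_generator_graph[OF null] by (auto simp: generator_dom_def)
    moreover have "(\<lambda>x. ?u x * v x) \<in> generator_dom m U \<and>
        (AE x in m. generator m U (\<lambda>x. ?u x * v x) x = ?u x * generator m U v x)"
      if v: "v \<in> generator_dom m U" for v
    proof -
      obtain w where w: "generator_graph m U v w"
        using v by (auto simp: generator_dom_def)
      note uw = invariant_indicator_mult_generator[OF B null w]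
      have "AE x in m. generator m U (\<lambda>x. ?u x * v x) x = ?u x * generator m U v x"
        using generator_AE[OF uw] generator_AE[OF w] by eventually_elim simp
      then show ?thesis
        using uw by (auto simp: generator_dom_def)
    qed
    ultimately have "ae_constant m ?u"
      using mult by blast
    then show "emeasure m A = 0 \<or> emeasure m ?B = 0"
      using AE_indicator_const[OF B] sets.sets_into_space[OF A]
      by (auto simp: ae_constant_def double_diff)
  qed
qed

section \<open>The ergodic theorem\<close>

abbreviation abel_norm :: "real \<Rightarrow> ('a \<Rightarrow> real) \<Rightarrow> real" where
  "abel_norm \<alpha> f \<equiv> L2_inner m (\<lambda>x. \<alpha> * kernel_op U \<alpha> f x) (\<lambda>x. \<alpha> * kernel_op U \<alpha> f x)"

lemma abel_norm_add:
  assumes "\<alpha> > 0" "f \<in> L2 m" "g \<in> L2 m" "h \<in> L2 m" "AE x in m. h x = f x + g x"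
  shows "abel_norm \<alpha> h \<le> 2 * abel_norm \<alpha> f + 2 * abel_norm \<alpha> g"
proof -
  let ?k = "\<lambda>x. \<alpha> * kernel_op U \<alpha> f x + \<alpha> * kernel_op U \<alpha> g x"
  have fg: "(\<lambda>y. f y + g y) \<in> L2 m"
    using assms L2_add by blast
  note L = L2_scale[OF kernel_op_L2[OF assms(1,2)], of \<alpha>] L2_scale[OF kernel_op_L2[OF assms(1,3)], of \<alpha>]
    L2_scale[OF kernel_op_L2[OF assms(1,4)], of \<alpha>]
  have eq: "AE x in m. \<alpha> * kernel_op U \<alpha> h x = ?k x"
    using kernel_op_cong_AE[OF assms(1,4) fg assms(5)] kernel_op_add[OF assms(1-3)]
    by eventually_elim (metis distrib_left)
  have "abel_norm \<alpha> h = L2_inner m ?k ?k"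
    by (intro L2_inner_self_cong_AE eq L L2_add)
  also have "\<dots> \<le> 2 * abel_norm \<alpha> f + 2 * abel_norm \<alpha> g"
    by (intro L2_inner_sum_le L)
  finally show ?thesis .
qed

lemma abel_norm_scale: "abel_norm \<alpha> (\<lambda>x. c * f x) = c\<^sup>2 * abel_norm \<alpha> f"
  by (simp add: kernel_op_scale L2_inner_scale_left L2_inner_scale_right power2_eq_square)

text \<open>These are von Neumann's coboundaries: with \<open>g = U\<^sub>1 r\<close> the resolvent
  equation gives \<open>U\<^sub>\<alpha> (g - r) = \<alpha> U\<^sub>\<alpha> g - g\<close>, which
  stays bounded in norm, so one more factor \<alpha> sends it to 0.\<close>

lemma abel_norm_resolvent_tendsto:
  assumes r: "r \<in> L2 m"
  shows "((\<lambda>\<alpha>. abel_norm \<alpha> (\<lambda>x. kernel_op U 1 r x - r x)) \<longlongrightarrow> 0) (at_right 0)"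
proof -
  let ?g = "kernel_op U 1 r"
  have g: "?g \<in> L2 m" and d: "(\<lambda>x. ?g x - r x) \<in> L2 m"
    using r kernel_op_L2 L2_diff by (metis zero_less_one)+
  have bound: "abel_norm \<alpha> (\<lambda>x. ?g x - r x) \<le> 4 * \<alpha>\<^sup>2 * L2_inner m ?g ?g" if a: "\<alpha> > 0" for \<alpha>
  proof -
    let ?k = "\<lambda>x. \<alpha> * kernel_op U \<alpha> ?g x"
    have kD: "(\<lambda>x. ?k x - ?g x) \<in> D"
      using a g r by (intro D_diff D_scale kernel_op_D) simp_all
    have k: "?k \<in> L2 m"
      by (rule L2_scale[OF kernel_op_L2[OF a g]])
    have "AE x in m. ?k x - ?g x = kernel_op U \<alpha> (\<lambda>x. ?g x - r x) x"
    proof (rule kernel_op_unique[OF a d kD])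
      fix v assume v: "v \<in> D"
      have "\<E> (kernel_op U \<alpha> ?g) v = L2_inner m ?g v - \<alpha> * L2_inner m (kernel_op U \<alpha> ?g) v"
        "\<E> ?g v = L2_inner m r v - L2_inner m ?g v"
        using kernel_op_energy[OF a g v] kernel_op_energy[OF _ r v, of 1] by simp_all
      then show "\<E> (\<lambda>x. ?k x - ?g x) v + \<alpha> * L2_inner m (\<lambda>x. ?k x - ?g x) v
          = L2_inner m (\<lambda>x. ?g x - r x) v"
        using a g r kernel_op_D[OF a g] kernel_op_D[OF _ r, of 1] D_L2[OF v] kernel_op_L2[OF a g]
          v by (simp add: form_simps L2_inner_simps right_diff_distrib)
    qed
    then have eq: "AE x in m. \<alpha> * kernel_op U \<alpha> (\<lambda>x. ?g x - r x) x = \<alpha> * (?k x - ?g x)"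
      by eventually_elim simp
    have L: "(\<lambda>x. \<alpha> * kernel_op U \<alpha> (\<lambda>x. ?g x - r x) x) \<in> L2 m" "(\<lambda>x. \<alpha> * (?k x - ?g x)) \<in> L2 m"
      using a d k g by (auto intro!: L2_scale L2_diff kernel_op_L2)
    have "abel_norm \<alpha> (\<lambda>x. ?g x - r x)
        = L2_inner m (\<lambda>x. \<alpha> * (?k x - ?g x)) (\<lambda>x. \<alpha> * (?k x - ?g x))"
      by (intro L2_inner_self_cong_AE eq L)
    also have "\<dots> = \<alpha>\<^sup>2 * L2_inner m (\<lambda>x. ?k x - ?g x) (\<lambda>x. ?k x - ?g x)"
      by (simp only: L2_inner_scale_left L2_inner_scale_right power2_eq_square mult.assoc)
    also have "\<dots> \<le> \<alpha>\<^sup>2 * (4 * L2_inner m ?g ?g)"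
      using L2_inner_diff_le[OF k g] kernel_op_contraction[OF a g] by (intro mult_left_mono) auto
    finally show ?thesis
      by simp
  qed
  have "((\<lambda>\<alpha>. 4 * \<alpha>\<^sup>2 * L2_inner m ?g ?g) \<longlongrightarrow> 4 * 0\<^sup>2 * L2_inner m ?g ?g) (at_right 0)"
    by (intro tendsto_intros)
  then have lim: "((\<lambda>\<alpha>. 4 * \<alpha>\<^sup>2 * L2_inner m ?g ?g) \<longlongrightarrow> 0) (at_right 0)"
    by simp
  show ?thesis
    by (rule tendsto_0_le_at_right[OF lim L2_inner_self_nonneg bound])
qed

text \<open>
  Among the functions \<open>r\<close> with \<open>\<alpha> U\<^sub>\<alpha> (u - r) \<rightarrow> 0\<close>, those of nearly minimal norm are
  nearly fixed by \<open>U\<^sub>1\<close>, by the parallelogram law; hence \<open>U\<^sub>1 r\<close> has small energy, and irreducibility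
  forces the minimum to be attained at a constant.
\<close>

lemma abel_norm_tendsto_0:
  assumes const: "\<And>u. u \<in> D \<Longrightarrow> \<E> u u = 0 \<Longrightarrow> ae_constant m u"
    and u: "u \<in> L2 m" and mean: "(\<integral>x. u x \<partial>m) = 0"
  shows "((\<lambda>\<alpha>. abel_norm \<alpha> u) \<longlongrightarrow> 0) (at_right 0)"
proof -
  define S where "S = {r \<in> L2 m. (\<integral>x. r x \<partial>m) = 0 \<and>
    ((\<lambda>\<alpha>. abel_norm \<alpha> (\<lambda>x. u x - r x)) \<longlongrightarrow> 0) (at_right 0)}"
  define d where "d = (INF r\<in>S. L2_inner m r r)"
  have pos: "\<forall>\<^sub>F \<alpha> in at_right 0. (0::real) < \<alpha>"
    by (simp add: eventually_at_filter)
  \<comment> \<open>For \<open>r = u\<close> the difference is 0; thus \<open>S\<close> is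
    nonempty.\<close>
  have uS: "u \<in> S"
    using u mean by (simp add: S_def kernel_op_def L2_inner_def)
  have bdd: "bdd_below ((\<lambda>r. L2_inner m r r) ` S)"
    by (intro bdd_belowI2[of _ 0] L2_inner_self_nonneg)
  have d_le: "d \<le> L2_inner m r r" if "r \<in> S" for r
    unfolding d_def using bdd that by (rule cINF_lower)
  \<comment> \<open>Passing from \<open>r\<close> to its image changes \<open>u - r\<close> by a
    coboundary, and preservation of mass keeps the mean 0.\<close>
  have PS: "kernel_op U 1 r \<in> S" if r: "r \<in> S" for r
  proof -
    have rL: "r \<in> L2 m"
      using r by (simp add: S_def)
    have PL: "kernel_op U 1 r \<in> L2 m"
      using kernel_op_L2[OF _ rL, of 1] by simp
    have *: "abel_norm \<alpha> (\<lambda>x. u x - kernel_op U 1 r x)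
        \<le> 2 * abel_norm \<alpha> (\<lambda>x. u x - r x) + 2 * abel_norm \<alpha> (\<lambda>x. kernel_op U 1 r x - r x)"
      if "\<alpha> > 0" for \<alpha>
      using abel_norm_add[OF that, of "\<lambda>x. u x - r x" "\<lambda>x. - 1 * (kernel_op U 1 r x - r x)"
          "\<lambda>x. u x - kernel_op U 1 r x"] u rL PL
      unfolding abel_norm_scale by (simp add: L2_diff L2_scale[of _ m "- 1", simplified])
    have lim: "((\<lambda>\<alpha>. 2 * abel_norm \<alpha> (\<lambda>x. u x - r x) + 2 * abel_norm \<alpha> (\<lambda>x. kernel_op U 1 r x - r x))
        \<longlongrightarrow> 2 * 0 + 2 * 0) (at_right 0)"
      using r abel_norm_resolvent_tendsto[OF rL] by (intro tendsto_intros) (simp_all add: S_def)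
    have "((\<lambda>\<alpha>. abel_norm \<alpha> (\<lambda>x. u x - kernel_op U 1 r x)) \<longlongrightarrow> 0) (at_right 0)"
      using lim by (intro tendsto_0_le_at_right[OF _ L2_inner_self_nonneg *]) simp_all
    then show ?thesis
      using r PL integral_kernel_op[OF _ rL, of 1] by (simp add: S_def)
  qed
  have midS: "(\<lambda>x. (r x + s x) / 2) \<in> S" if r: "r \<in> S" and s: "s \<in> S" for r s
  proof -
    let ?h = "\<lambda>x. 1 / 2 * (r x + s x)"
    have L: "r \<in> L2 m" "s \<in> L2 m"
      using r s by (auto simp: S_def)
    have hL: "?h \<in> L2 m"
      by (intro L2_scale L2_add L)
    have *: "abel_norm \<alpha> (\<lambda>x. u x - ?h x)
        \<le> 2 * ((1/2)\<^sup>2 * abel_norm \<alpha> (\<lambda>x. u x - r x)) + 2 * ((1/2)\<^sup>2 * abel_norm \<alpha> (\<lambda>x. u x - s x))"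
      if "\<alpha> > 0" for \<alpha>
      unfolding abel_norm_scale[symmetric]
      using that by (intro abel_norm_add L2_scale L2_diff L2_add u L) (auto intro!: AE_I2 simp: field_simps)
    have lim: "((\<lambda>\<alpha>. 2 * ((1/2)\<^sup>2 * abel_norm \<alpha> (\<lambda>x. u x - r x))
          + 2 * ((1/2)\<^sup>2 * abel_norm \<alpha> (\<lambda>x. u x - s x)))
        \<longlongrightarrow> 2 * ((1/2)\<^sup>2 * 0) + 2 * ((1/2)\<^sup>2 * 0)) (at_right 0)"
      using r s unfolding S_def by (intro tendsto_add tendsto_mult tendsto_const) auto
    have "((\<lambda>\<alpha>. abel_norm \<alpha> (\<lambda>x. u x - ?h x)) \<longlongrightarrow> 0) (at_right 0)"
      using lim by (intro tendsto_0_le_at_right[OF _ L2_inner_self_nonneg *]) simp_all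
    moreover have "(\<integral>x. ?h x \<partial>m) = 0"
      using r s L2_integrable[OF L(1)] L2_integrable[OF L(2)] by (simp add: S_def)
    ultimately show ?thesis
      using hL by (simp add: S_def)
  qed
  have "\<exists>r\<in>S. L2_inner m r r < d + 1 / real (Suc n)" for n
  proof -
    have "(INF r\<in>S. L2_inner m r r) < d + 1 / real (Suc n)"
      by (simp add: d_def)
    then show ?thesis
      using cINF_less_iff[OF _ bdd, of "d + 1 / real (Suc n)"] uS by blast
  qed
  then obtain r where rS: "\<And>n. r n \<in> S"
    and r_lt: "\<And>n. L2_inner m (r n) (r n) < d + 1 / real (Suc n)"
    by metis
  define v where "v n = kernel_op U 1 (r n)" for n
  have rL: "r n \<in> L2 m" for n
    using rS by (simp add: S_def)
  have vS: "v n \<in> S" for n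
    unfolding v_def using rS by (rule PS)
  have vD: "v n \<in> D" for n
    unfolding v_def using rL by (intro kernel_op_D) simp_all
  have vL: "v n \<in> L2 m" for n
    using vD D_L2 by blast
  have v_le: "L2_inner m (v n) (v n) \<le> L2_inner m (r n) (r n)" for n
    using kernel_op_contraction[OF _ rL[of n], of 1] by (simp add: v_def)
  have lim0: "(\<lambda>n. 1 / real (Suc n)) \<longlonglongrightarrow> 0"
    using LIMSEQ_Suc[OF lim_const_over_n[of "1 :: real"]] by simp
  \<comment> \<open>The energy is (r, v) - (v, v), at most half of (r, r) - (v, v); since
    \<open>v n\<close> lies in \<open>S\<close>, (v, v) is at least \<open>d\<close>.\<close>
  have "\<E> (v n) (v n) \<le> 1 / real (Suc n)" for n
  proof -
    have "\<E> (v n) (v n) = L2_inner m (r n) (v n) - L2_inner m (v n) (v n)"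
      using kernel_op_energy[OF _ rL[of n] vD[of n], of 1] by (simp add: v_def)
    moreover have "0 \<le> 1 / real (Suc n)"
      by simp
    ultimately show ?thesis
      using L2_inner_le[OF rL[of n] vL[of n]] r_lt[of n] d_le[OF vS[of n]] by linarith
  qed
  then have null: "(\<lambda>n. \<E> (v n) (v n)) \<longlonglongrightarrow> 0"
    by (intro tendsto_sandwich[OF _ _ tendsto_const lim0])
      (auto intro!: always_eventually nonneg vD simp del: of_nat_Suc)
  have "\<exists>N. \<forall>i\<ge>N. \<forall>j\<ge>N. L2_inner m (\<lambda>x. v i x - v j x) (\<lambda>x. v i x - v j x) < e"
    if e: "e > 0" for e
  proof -
    obtain N where "inverse (real (Suc N)) < e / 4"
      using reals_Archimedean[of "e / 4"] e by auto
    then have N: "1 / real (Suc N) < e / 4"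
      by (simp add: inverse_eq_divide)
    show ?thesis
    proof (intro exI[of _ N] allI impI)
      fix i j assume ij: "N \<le> i" "N \<le> j"
      have lt: "L2_inner m (v n) (v n) < d + e / 4" if "N \<le> n" for n
      proof -
        have "1 / real (Suc n) \<le> 1 / real (Suc N)"
          using that by (simp add: frac_le)
        then show ?thesis
          using v_le[of n] r_lt[of n] N by linarith
      qed
      \<comment> \<open>The midpoint lies in \<open>S\<close>, so the sum has squared norm at least
        4 d; the parallelogram law leaves less than 4 (d + e/4) - 4 d = e.\<close>
      have "d \<le> L2_inner m (\<lambda>x. 1 / 2 * (v i x + v j x)) (\<lambda>x. 1 / 2 * (v i x + v j x))"
        using d_le[OF midS[OF vS[of i] vS[of j]]] by simp
      also have "\<dots> = L2_inner m (\<lambda>x. v i x + v j x) (\<lambda>x. v i x + v j x) / 4"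
        unfolding L2_inner_scale_left L2_inner_scale_right by simp
      finally show "L2_inner m (\<lambda>x. v i x - v j x) (\<lambda>x. v i x - v j x) < e"
        using L2_parallelogram[OF vL[of i] vL[of j]] lt[OF ij(1)] lt[OF ij(2)] by linarith
    qed
  qed
  then obtain w where w: "w \<in> D" "\<E> w w = 0"
    and w_lim: "(\<lambda>n. L2_inner m (\<lambda>x. v n x - w x) (\<lambda>x. v n x - w x)) \<longlonglongrightarrow> 0"
    using energy_null_Cauchy[OF vD null] by blast
  obtain c where c: "AE x in m. w x = c"
    using const[OF w] by (auto simp: ae_constant_def)
  \<comment> \<open>\<open>v n\<close> has mean 0, so it is orthogonal to the constant
    \<open>w\<close>, and Pythagoras applies.\<close>
  have v_norm: "L2_inner m (v n) (v n) \<le> L2_inner m (\<lambda>x. v n x - w x) (\<lambda>x. v n x - w x)" for n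
  proof -
    have "L2_inner m w (v n) = L2_inner m (\<lambda>_. c) (v n)"
      using c by (intro L2_inner_cong_AE D_L2 w vD const_D)
    also have "\<dots> = 0"
      using vS[of n] by (simp add: S_def L2_inner_def)
    finally show ?thesis
      using vL[of n] D_L2[OF w(1)] L2_inner_self_nonneg[of m w]
      by (simp add: L2_inner_simps L2_inner_commute[of m "v n" w])
  qed
  have v_lim: "(\<lambda>n. L2_inner m (v n) (v n)) \<longlonglongrightarrow> 0"
    by (rule tendsto_sandwich[OF _ _ tendsto_const w_lim])
      (auto intro!: always_eventually v_norm L2_inner_self_nonneg)
  show ?thesis
  proof (rule order_tendstoI)
    fix a :: real assume "a < 0"
    then show "\<forall>\<^sub>F \<alpha> in at_right 0. a < abel_norm \<alpha> u"
      by (intro always_eventually allI less_le_trans[OF _ L2_inner_self_nonneg])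
  next
    fix e :: real assume e: "0 < e"
    then obtain n where n: "L2_inner m (v n) (v n) < e / 4"
      using eventually_happens[OF order_tendstoD(2)[OF v_lim, of "e / 4"]] by auto
    have "((\<lambda>\<alpha>. abel_norm \<alpha> (\<lambda>x. u x - v n x)) \<longlongrightarrow> 0) (at_right 0)"
      using vS[of n] by (simp add: S_def)
    then have "\<forall>\<^sub>F \<alpha> in at_right 0. abel_norm \<alpha> (\<lambda>x. u x - v n x) < e / 4"
      by (rule order_tendstoD(2)) (use e in simp)
    with pos show "\<forall>\<^sub>F \<alpha> in at_right 0. abel_norm \<alpha> u < e"
    proof eventually_elim
      case (elim \<alpha>)
      have "abel_norm \<alpha> u \<le> 2 * abel_norm \<alpha> (\<lambda>x. u x - v n x) + 2 * abel_norm \<alpha> (v n)"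
        using u vL elim(1) by (intro abel_norm_add L2_diff) auto
      then show ?case
        using elim(2) n kernel_op_contraction[OF elim(1) vL[of n]] by linarith
    qed
  qed
qed

text \<open>Forward, constants are fixed by the operators, so \<open>u\<close> may be centred at its
  mean. Backward, a function of energy 0 is fixed, so the integral does not depend on \<alpha> and
  its limit is the squared distance from \<open>u\<close> to its mean.\<close>

lemma irreducible_iff_ergodic:
  "irreducible_resolvent m U \<longleftrightarrow>
    (\<forall>u\<in>L2 m.
      ((\<lambda>\<alpha>. \<integral>x. (\<alpha> * kernel_op U \<alpha> u x
          - 1 / measure m (space m) * (\<integral>y. u y \<partial>m))\<^sup>2 \<partial>m) \<longlongrightarrow> 0) (at_right 0))"
  (is "_ \<longleftrightarrow> (\<forall>u\<in>L2 m. (?F u \<longlongrightarrow> 0) _)")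
  unfolding irreducible_iff_energy
proof (intro iffI ballI impI)
  fix u assume const: "\<forall>u\<in>D. \<E> u u = 0 \<longrightarrow> ae_constant m u" and u: "u \<in> L2 m"
  define c where "c = 1 / measure m (space m) * (\<integral>y. u y \<partial>m)"
  have uc: "(\<lambda>x. u x - c) \<in> L2 m"
    using u const_L2 L2_diff by blast
  have "(\<integral>x. u x - c \<partial>m) = (\<integral>x. u x \<partial>m) - measure m (space m) * c"
    using L2_integrable[OF u] by simp
  also have "\<dots> = 0"
  proof (cases "measure m (space m) = 0")
    \<comment> \<open>Here the quotient in \<open>c\<close> has the default value 0; the integral of
      \<open>u\<close> vanishes because \<open>m\<close> is null.\<close>
    case True
    then have "AE x in m. x \<notin> space m"
      by (intro AE_not_in) (auto simp: emeasure_eq_measure)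
    with AE_space have "AE x in m. u x = 0"
      by eventually_elim simp
    then show ?thesis
      using True by (simp add: integral_eq_zero_AE)
  qed (simp add: c_def)
  finally have lim: "((\<lambda>\<alpha>. abel_norm \<alpha> (\<lambda>x. u x - c)) \<longlongrightarrow> 0) (at_right 0)"
    using const uc by (intro abel_norm_tendsto_0) auto
  have "\<forall>\<^sub>F \<alpha> in at_right 0. abel_norm \<alpha> (\<lambda>x. u x - c) = ?F u \<alpha>"
  proof -
    have "abel_norm \<alpha> (\<lambda>x. u x - c) = ?F u \<alpha>" if a: "\<alpha> > 0" for \<alpha>
    proof -
      have ae: "AE x in m. \<alpha> * kernel_op U \<alpha> (\<lambda>x. u x - c) x = \<alpha> * kernel_op U \<alpha> u x - c"
        using kernel_op_add[OF a uc const_L2, of c] energy_null_fixed[OF a const_D form_const, of c]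
      proof eventually_elim
        case (elim x)
        then have "kernel_op U \<alpha> u x = kernel_op U \<alpha> (\<lambda>x. u x - c) x + kernel_op U \<alpha> (\<lambda>_. c) x"
          by simp
        then show ?case
          using elim(2) by (simp add: distrib_left)
      qed
      have "(\<lambda>x. \<alpha> * kernel_op U \<alpha> (\<lambda>x. u x - c) x) \<in> borel_measurable m"
        "(\<lambda>x. \<alpha> * kernel_op U \<alpha> u x - c) \<in> borel_measurable m"
        using L2_measurable[OF kernel_op_L2[OF a uc]] L2_measurable[OF kernel_op_L2[OF a u]] by auto
      with ae show ?thesis
        unfolding L2_inner_def power2_eq_square c_def[symmetric]
        by (intro integral_cong_AE) (auto elim!: eventually_mono)
    qed
    then show ?thesis
      by (simp add: eventually_at_filter)
  qed
  then show "(?F u \<longlongrightarrow> 0) (at_right 0)"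
    by (rule Lim_transform_eventually[OF lim])
next
  fix u assume erg: "\<forall>u\<in>L2 m. (?F u \<longlongrightarrow> 0) (at_right 0)" and u: "u \<in> D" "\<E> u u = 0"
  define c where "c = 1 / measure m (space m) * (\<integral>y. u y \<partial>m)"
  have uL: "u \<in> L2 m"
    using u D_L2 by blast
  have uc: "(\<lambda>x. u x - c) \<in> L2 m"
    using uL const_L2 L2_diff by blast
  have "\<forall>\<^sub>F \<alpha> in at_right 0. ?F u \<alpha> = L2_inner m (\<lambda>x. u x - c) (\<lambda>x. u x - c)"
  proof -
    have "?F u \<alpha> = L2_inner m (\<lambda>x. u x - c) (\<lambda>x. u x - c)" if a: "\<alpha> > 0" for \<alpha>
      unfolding L2_inner_def power2_eq_square c_def[symmetric]
      using energy_null_fixed[OF a u] L2_measurable[OF kernel_op_L2[OF a uL]] L2_measurable[OF uL]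
      by (intro integral_cong_AE) (auto elim!: eventually_mono)
    then show ?thesis
      by (simp add: eventually_at_filter)
  qed
  then have "((\<lambda>_. L2_inner m (\<lambda>x. u x - c) (\<lambda>x. u x - c)) \<longlongrightarrow> 0) (at_right (0::real))"
    by (rule Lim_transform_eventually[OF bspec[OF erg uL]])
  then have "L2_inner m (\<lambda>x. u x - c) (\<lambda>x. u x - c) = 0"
    by (simp add: tendsto_const_iff)
  then have "AE x in m. u x - c = 0"
    by (rule L2_inner_self_eq_0[OF uc])
  then show "ae_constant m u"
    unfolding ae_constant_def by (intro exI[of _ c]) (auto elim!: eventually_mono)
qed

end

context form_resolvent
begin

lemma recurrent_iff: "recurrent m U \<longleftrightarrow> (\<lambda>_. 1) \<in> D \<and> \<E> (\<lambda>_. 1) (\<lambda>_. 1) = 0"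
proof
  assume "(\<lambda>_. 1) \<in> D \<and> \<E> (\<lambda>_. 1) (\<lambda>_. 1) = 0"
  then interpret conservative_form m D \<E> U
    by unfold_locales auto
  show "recurrent m U"
    by (rule conservative_recurrent)
qed (rule recurrent_imp_conservative)

end

section \<open>The symmetric part\<close>

text \<open>Closedness already concerns the symmetric part, and symmetrizing twice changes nothing.
  The sector bound averages the two orders of the arguments, and both contraction inequalities
  become \<open>form_contraction_self_le\<close>.\<close>

lemma (in dirichlet_form) dirichlet_form_sym_part: "dirichlet_form m D (sym_part \<E>)"
proof
  show "sym_part \<E> u w = sym_part \<E> v w \<and> sym_part \<E> w u = sym_part \<E> w v"
    if "u \<in> D" "v \<in> D" "w \<in> D" "AE x in m. u x = v x" for u v w
    using form_cong[OF that] by (simp add: sym_part_def)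
  show "\<exists>K>0. \<forall>u\<in>D. \<forall>v\<in>D. \<bar>form_shift m (sym_part \<E>) 1 u v\<bar>
      \<le> K * sqrt (form_shift m (sym_part \<E>) 1 u u) * sqrt (form_shift m (sym_part \<E>) 1 v v)"
  proof -
    obtain K where K: "K > 0" and sect: "\<And>u v. u \<in> D \<Longrightarrow> v \<in> D \<Longrightarrow>
        \<bar>form_shift m \<E> 1 u v\<bar> \<le> K * sqrt (form_shift m \<E> 1 u u) * sqrt (form_shift m \<E> 1 v v)"
      using weak_sector by blast
    have "\<bar>form_shift m (sym_part \<E>) 1 u v\<bar>
      \<le> K * sqrt (form_shift m (sym_part \<E>) 1 u u) * sqrt (form_shift m (sym_part \<E>) 1 v v)"
      if "u \<in> D" "v \<in> D" for u v
    proof -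
      have "form_shift m (sym_part \<E>) 1 u v = (form_shift m \<E> 1 u v + form_shift m \<E> 1 v u) / 2"
        by (simp add: form_shift_def sym_part_def L2_inner_commute[of m v u] add_divide_distrib)
      moreover have "\<bar>form_shift m \<E> 1 v u\<bar>
          \<le> K * sqrt (form_shift m \<E> 1 u u) * sqrt (form_shift m \<E> 1 v v)"
        using sect[OF that(2,1)] by (simp add: ac_simps)
      moreover have "form_shift m (sym_part \<E>) 1 w w = form_shift m \<E> 1 w w" for w
        by (simp add: form_shift_def sym_part_def)
      ultimately show ?thesis
        using sect[OF that] by simp
    qed
    then show ?thesis
      using K by blast
  qed
  show "\<exists>w\<in>D. (\<lambda>n. form_shift m (sym_part (sym_part \<E>)) 1 (\<lambda>x. u n x - w x) (\<lambda>x. u n x - w x))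
          \<longlonglongrightarrow> 0"
    if "\<And>n. u n \<in> D" "\<And>\<epsilon>. \<epsilon> > 0 \<Longrightarrow> \<exists>N. \<forall>i\<ge>N. \<forall>j\<ge>N.
          form_shift m (sym_part (sym_part \<E>)) 1 (\<lambda>x. u i x - u j x) (\<lambda>x. u i x - u j x) < \<epsilon>" for u
  proof -
    have "sym_part (sym_part \<E>) = sym_part \<E>"
      by (intro ext) (simp add: sym_part_def add.commute)
    then show ?thesis
      using closed[of u] that by simp
  qed
qed (auto simp: sym_part_def D_subset D_zero D_add D_scale form_simps dense nonneg contraction_mem
    form_contraction_self_le distrib_left add_divide_distrib intro: D_cong)

lemma strong_sector_sym_part:
  assumes "strong_sector D \<E>"
  shows "strong_sector D (sym_part \<E>)"
proof -
  obtain k where k: "k > 0"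
    and sect: "\<And>u v. u \<in> D \<Longrightarrow> v \<in> D \<Longrightarrow> \<bar>\<E> u v\<bar> \<le> k * sqrt (\<E> u u) * sqrt (\<E> v v)"
    using assms unfolding strong_sector_def by blast
  have "\<bar>sym_part \<E> u v\<bar> \<le> k * sqrt (sym_part \<E> u u) * sqrt (sym_part \<E> v v)"
    if "u \<in> D" "v \<in> D" for u v
  proof -
    have "\<bar>\<E> v u\<bar> \<le> k * sqrt (\<E> u u) * sqrt (\<E> v v)"
      using sect[OF that(2,1)] by (simp add: ac_simps)
    then show ?thesis
      using sect[OF that] by (simp add: sym_part_def)
  qed
  then show ?thesis
    using k unfolding strong_sector_def by blast
qed

lemma form_resolventI:
  assumes "finite_measure m" "dirichlet_form m D \<E>" "strong_sector D \<E>" "resolvent_of_form m D \<E> U"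
  shows "form_resolvent m D \<E> U"
  using assms
  by (auto simp: form_resolvent_def form_resolvent_axioms_def resolvent_of_form_def)

theorem corollary5p4:
  fixes m :: "'a measure" and D :: "('a \<Rightarrow> real) set" and \<E> :: "'a form"
    and U Usym :: "'a kernel_family"
  assumes lusin: "lusin_measurable_space m"
    and finite_m: "finite_measure m"
    and dirichlet: "dirichlet_form m D \<E>"
    and sector: "strong_sector D \<E>"
    and resolvent: "resolvent_of_form m D \<E> U"
    and resolvent_sym: "resolvent_of_form m D (sym_part \<E>) Usym"
  shows
    "((recurrent m U \<longleftrightarrow> recurrent m Usym) \<and>
      (recurrent m U \<longleftrightarrow> (\<lambda>x. 1) \<in> D \<and> \<E> (\<lambda>x. 1) (\<lambda>x. 1) = 0)) \<and>
     (recurrent m U \<longrightarrow>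
      (irreducible_resolvent m U \<longleftrightarrow> irreducible_resolvent m Usym) \<and>
      (irreducible_resolvent m U \<longleftrightarrow> (\<forall>u\<in>D. \<E> u u = 0 \<longrightarrow> ae_constant m u)) \<and>
      (irreducible_resolvent m U \<longleftrightarrow>
        (\<forall>u\<in>generator_dom m U. (AE x in m. generator m U u x = 0) \<longrightarrow> ae_constant m u)) \<and>
      (irreducible_resolvent m U \<longleftrightarrow>
        (\<forall>u\<in>generator_dom m U.
          (\<forall>v\<in>generator_dom m U.
            (\<lambda>x. u x * v x) \<in> generator_dom m U \<and>
            (AE x in m. generator m U (\<lambda>x. u x * v x) x = u x * generator m U v x)) \<longrightarrow>
          ae_constant m u)) \<and>
      (irreducible_resolvent m U \<longleftrightarrow>
        (\<forall>u\<in>L2 m.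
          ((\<lambda>\<alpha>. \<integral>x. (\<alpha> * kernel_op U \<alpha> u x
              - 1 / measure m (space m) * (\<integral>y. u y \<partial>m))\<^sup>2 \<partial>m) \<longlongrightarrow> 0) (at_right 0))))"
proof -
  interpret R: form_resolvent m D \<E> U
    using finite_m dirichlet sector resolvent by (rule form_resolventI)
  interpret S: form_resolvent m D "sym_part \<E>" Usym
    using finite_m R.dirichlet_form_sym_part strong_sector_sym_part[OF sector] resolvent_sym
    by (rule form_resolventI)
  have sym: "sym_part \<E> u u = \<E> u u" for u
    by (simp add: sym_part_def)
  show ?thesis
  proof (intro conjI impI)
    show "recurrent m U \<longleftrightarrow> recurrent m Usym"
      by (simp add: R.recurrent_iff S.recurrent_iff sym)
    show "recurrent m U \<longleftrightarrow> (\<lambda>x. 1) \<in> D \<and> \<E> (\<lambda>x. 1) (\<lambda>x. 1) = 0"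
      by (rule R.recurrent_iff)
  next
    assume rec: "recurrent m U"
    interpret RC: conservative_form m D \<E> U
      using rec by unfold_locales (simp_all add: R.recurrent_iff)
    \<comment> \<open>The criterion \<E>(1, 1) = 0 is the same for both forms, so recurrence of
      \<open>U\<close> alone makes the symmetric part conservative.\<close>
    interpret SC: conservative_form m D "sym_part \<E>" Usym
      using rec by unfold_locales (simp_all add: R.recurrent_iff sym)
    show "irreducible_resolvent m U \<longleftrightarrow> irreducible_resolvent m Usym"
      by (simp add: RC.irreducible_iff_energy SC.irreducible_iff_energy sym)
    show "irreducible_resolvent m U \<longleftrightarrow> (\<forall>u\<in>D. \<E> u u = 0 \<longrightarrow> ae_constant m u)"
      by (rule RC.irreducible_iff_energy)
    show "irreducible_resolvent m U \<longleftrightarrow>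
        (\<forall>u\<in>generator_dom m U. (AE x in m. generator m U u x = 0) \<longrightarrow> ae_constant m u)"
      by (rule RC.irreducible_iff_generator)
    show "irreducible_resolvent m U \<longleftrightarrow>
        (\<forall>u\<in>generator_dom m U.
          (\<forall>v\<in>generator_dom m U.
            (\<lambda>x. u x * v x) \<in> generator_dom m U \<and>
            (AE x in m. generator m U (\<lambda>x. u x * v x) x = u x * generator m U v x)) \<longrightarrow>
          ae_constant m u)"
      by (rule RC.irreducible_iff_multiplier)
    show "irreducible_resolvent m U \<longleftrightarrow>
        (\<forall>u\<in>L2 m.
          ((\<lambda>\<alpha>. \<integral>x. (\<alpha> * kernel_op U \<alpha> u x
              - 1 / measure m (space m) * (\<integral>y. u y \<partial>m))\<^sup>2 \<partial>m) \<longlongrightarrow> 0) (at_right 0))"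
      by (rule RC.irreducible_iff_ergodic)
  qed
qed

end
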